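(* There exist a countable-state, irreducible, aperiodic, positive recurrent Markov transition kernel $P$ with stationary distribution $\pi$ and a function $h\in L^2(\pi)$ with $\pi(h)=0$ such that $$A=\lim_{n\to\infty}A_n=1,\qquad\liminf_{n\to\infty}B_n=1,\qquad\limsup_{n\to\infty}B_n=\infty.$$ The construction can be modified so that $P=P_1P_2$, where $P_1$ and $P_2$ are reversible Markov transition kernels (with respect to $\pi$); that is, $P$ and $h$ with all the stated properties can also be chosen with $P$ of this form. Moreover, $h$ satisfies a $\sqrt n$-CLT.
   Context: $(X_n)_{n\ge0}$ is the stationary chain with kernel $P$ ($X_0\sim\pi$), $S_n=\sum_{k=0}^{n-1}h(X_k)$, $A_n=\frac1n\operatorname{Var}_\pi(S_n)$, $\gamma_k=\mathbb E_\pi[h(X_0)h(X_k)]$, $B_n=\gamma_0+2\sum_{k=1}^n\gamma_k$. $P_1P_2$ is the composition of kernels (first apply $P_1$, then $P_2$); $P_i$ reversible with respect to $\pi$ means $\pi(x)P_i(x,y)=\pi(y)P_i(y,x)$ for all states. A $\sqrt n$-CLT means $S_n/\sqrt n$ converges weakly to $\mathsf N(0,\sigma^2)$ for some $\sigma^2\in[0,\infty)$. *)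

theory Defs
  imports "HOL-Probability.Probability"
begin

text \<open>A Markov kernel on a discrete state space is a function of type \<open>'s \<Rightarrow> 's pmf\<close>.\<close>

text \<open>First \<open>P\<close>, then \<open>Q\<close>.\<close>

definition kernel_comp :: "('s \<Rightarrow> 's pmf) \<Rightarrow> ('s \<Rightarrow> 's pmf) \<Rightarrow> 's \<Rightarrow> 's pmf" where
  "kernel_comp P Q = (\<lambda>x. bind_pmf (P x) Q)"

primrec kernel_pow :: "('s \<Rightarrow> 's pmf) \<Rightarrow> nat \<Rightarrow> 's \<Rightarrow> 's pmf" where
  "kernel_pow P 0 = return_pmf"
| "kernel_pow P (Suc n) = kernel_comp (kernel_pow P n) P"

definition irreducible_kernel :: "('s \<Rightarrow> 's pmf) \<Rightarrow> bool" where
  "irreducible_kernel P \<longleftrightarrow> (\<forall>x y. \<exists>n. pmf (kernel_pow P n x) y > 0)"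

definition aperiodic_kernel :: "('s \<Rightarrow> 's pmf) \<Rightarrow> bool" where
  "aperiodic_kernel P \<longleftrightarrow> (\<forall>x. Gcd {n. 1 \<le> n \<and> pmf (kernel_pow P n x) x > 0} = 1)"

definition stationary_distribution :: "('s \<Rightarrow> 's pmf) \<Rightarrow> 's pmf \<Rightarrow> bool" where
  "stationary_distribution P \<pi> \<longleftrightarrow> bind_pmf \<pi> P = \<pi>"

definition reversible_kernel :: "'s pmf \<Rightarrow> ('s \<Rightarrow> 's pmf) \<Rightarrow> bool" where
  "reversible_kernel \<pi> P \<longleftrightarrow> (\<forall>x y. pmf \<pi> x * pmf (P x) y = pmf \<pi> y * pmf (P y) x)"

text \<open>
  \<open>chain \<mu> P\<close> is the law, on the sequence space \<open>nat \<Rightarrow> 's\<close>, of the Markov chain with initial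
  distribution \<open>\<mu>\<close> and kernel \<open>P\<close>; the random variable \<open>X\<^sub>k\<close> is the coordinate \<open>\<lambda>\<omega>. \<omega> k\<close>.
  The measure is the Ionescu-Tulcea limit of the one-step laws below; \<open>emeasure_chain_cylinder\<close>
  gives its finite-dimensional distributions.
\<close>

definition chain_step :: "'s pmf \<Rightarrow> ('s \<Rightarrow> 's pmf) \<Rightarrow> nat \<Rightarrow> (nat \<Rightarrow> 's) \<Rightarrow> 's measure" where
  "chain_step \<mu> P i \<omega> = measure_pmf (case i of 0 \<Rightarrow> \<mu> | Suc n \<Rightarrow> P (\<omega> n))"

definition chain :: "'s pmf \<Rightarrow> ('s \<Rightarrow> 's pmf) \<Rightarrow> (nat \<Rightarrow> 's) measure" where
  "chain \<mu> P = projective_family.lim UNIV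
     (Ionescu_Tulcea.CI (chain_step \<mu> P) (\<lambda>_. count_space UNIV)) (\<lambda>_. count_space UNIV)"

lemma Ionescu_Tulcea_chain_step:
  "Ionescu_Tulcea (chain_step \<mu> P) (\<lambda>_. count_space UNIV)"
proof (rule Ionescu_Tulcea.intro)
  fix i
  show "chain_step \<mu> P i \<in> Pi\<^sub>M {0..<i} (\<lambda>_. count_space UNIV) \<rightarrow>\<^sub>M subprob_algebra (count_space UNIV)"
  proof (cases i)
    case 0
    then show ?thesis
      by (simp add: chain_step_def[abs_def] measure_pmf_in_subprob_algebra)
  next
    case (Suc n)
    have "(\<lambda>\<omega>. measure_pmf (P (\<omega> n))) \<in> Pi\<^sub>M {0..<i} (\<lambda>_. count_space UNIV) \<rightarrow>\<^sub>M subprob_algebra (count_space UNIV)"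
      by (rule measurable_compose[OF measurable_component_singleton])
         (auto simp: Suc measure_pmf_in_subprob_algebra)
    then show ?thesis
      by (simp add: chain_step_def[abs_def] Suc)
  qed
qed (simp add: chain_step_def measure_pmf.prob_space_axioms)

lemma
  shows prob_space_chain: "prob_space (chain \<mu> P)"
    and sets_chain: "sets (chain \<mu> P) = sets (Pi\<^sub>M UNIV (\<lambda>_. count_space UNIV))"
    and space_chain: "space (chain \<mu> P) = UNIV"
proof -
  interpret Ionescu_Tulcea "chain_step \<mu> P" "\<lambda>_. count_space UNIV"
    by (rule Ionescu_Tulcea_chain_step)
  have 1: "emeasure (chain \<mu> P) UNIV = 1"
  proof -
    have "emeasure (CI {}) (space (CI {})) = 1"
      by (intro prob_space.emeasure_space_1 PF.prob_space_P) auto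
    then show ?thesis
      using lim[of "{}" "{\<lambda>_. undefined}"]
      by (simp add: chain_def prod_emb_def space_PiM CI_def restrict_def sets_PiM_empty)
  qed
  show sets: "sets (chain \<mu> P) = sets (Pi\<^sub>M UNIV (\<lambda>_. count_space UNIV))"
    unfolding chain_def by (rule PF.sets_lim)
  show space: "space (chain \<mu> P) = UNIV"
    using sets_eq_imp_space_eq[OF sets] by (simp add: space_PiM PiE_def extensional_def)
  show "prob_space (chain \<mu> P)"
    by standard (simp add: space 1)
qed

lemma emeasure_chain_cylinder:
  "emeasure (chain \<mu> P) {\<omega>. \<forall>i\<le>n. \<omega> i = x i} =
     ennreal (pmf \<mu> (x 0) * (\<Prod>i<n. pmf (P (x i)) (x (Suc i))))"
proof -
  interpret Ionescu_Tulcea "chain_step \<mu> P" "\<lambda>_. count_space UNIV"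
    by (rule Ionescu_Tulcea_chain_step)
  let ?M = "\<lambda>_::nat. count_space (UNIV :: 'a set)"
  have sing[measurable]: "{restrict x {0..<m}} \<in> sets (Pi\<^sub>M {0..<m} ?M)" for m
    using sets_PiM_I_finite[of "{0..<m}" "\<lambda>i. {restrict x {0..<m} i}" ?M]
    by (simp only: PiE_singleton[OF restrict_extensional]) simp
  have step: "emeasure (C 0 (Suc m) (\<lambda>_. undefined)) {restrict x {0..<Suc m}} =
      emeasure (C 0 m (\<lambda>_. undefined)) {restrict x {0..<m}} *
      emeasure (chain_step \<mu> P m x) {x m}" for m
  proof -
    have u: "(\<lambda>_. undefined) \<in> space (Pi\<^sub>M {0..<0} ?M)"
      by simp
    have "emeasure (C 0 (Suc m) (\<lambda>_. undefined)) {restrict x {0..<Suc m}} =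
        (\<integral>\<^sup>+\<omega>. emeasure (eP m \<omega>) {restrict x {0..<Suc m}} \<partial>C 0 m (\<lambda>_. undefined))"
      using space_C[OF u, of m] measurable_eP[of m]
      by (simp, intro emeasure_bind[OF _ _ sing]) (simp_all add: measurable_cong_sets[OF sets_C[OF u]])
    also have "\<dots> = (\<integral>\<^sup>+\<omega>. emeasure (chain_step \<mu> P m x) {x m} * indicator {restrict x {0..<m}} \<omega>
        \<partial>C 0 m (\<lambda>_. undefined))"
    proof (rule nn_integral_cong)
      fix \<omega> assume "\<omega> \<in> space (C 0 m (\<lambda>_. undefined))"
      then have \<omega>: "\<omega> \<in> space (Pi\<^sub>M {0..<m} ?M)"
        using space_C[OF u, of m] by simp
      then have ext: "\<omega> i = undefined" if "i \<ge> m" for i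
        using that by (auto simp: space_PiM PiE_def extensional_def)
      have upd: "fun_upd \<omega> m y = restrict x {0..<Suc m} \<longleftrightarrow> \<omega> = restrict x {0..<m} \<and> y = x m" for y
      proof
        assume eq: "fun_upd \<omega> m y = restrict x {0..<Suc m}"
        have "\<omega> i = restrict x {0..<m} i" for i
          using fun_cong[OF eq, of i] ext[of i] by (cases "i < m") auto
        then show "\<omega> = restrict x {0..<m} \<and> y = x m"
          using fun_cong[OF eq, of m] by auto
      qed (auto simp: fun_eq_iff)
      have "emeasure (eP m \<omega>) {restrict x {0..<Suc m}} =
          emeasure (chain_step \<mu> P m \<omega>) {y. \<omega> = restrict x {0..<m} \<and> y = x m}"
        by (subst emeasure_eP[OF \<omega> sing]) (simp add: vimage_def upd del: fun_upd_apply)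
      also have "\<dots> = emeasure (chain_step \<mu> P m x) {x m} * indicator {restrict x {0..<m}} \<omega>"
        by (cases "\<omega> = restrict x {0..<m}") (auto simp: chain_step_def split: nat.split)
      finally show "emeasure (eP m \<omega>) {restrict x {0..<Suc m}} =
          emeasure (chain_step \<mu> P m x) {x m} * indicator {restrict x {0..<m}} \<omega>" .
    qed
    also have "\<dots> = emeasure (chain_step \<mu> P m x) {x m} *
        emeasure (C 0 m (\<lambda>_. undefined)) {restrict x {0..<m}}"
      by (rule nn_integral_cmult_indicator) (simp add: sets_C[OF u] sing)
    finally show ?thesis
      by (simp add: mult.commute)
  qed
  have emC: "emeasure (C 0 (Suc n) (\<lambda>_. undefined)) {restrict x {0..<Suc n}} =
      ennreal (pmf \<mu> (x 0) * (\<Prod>i<n. pmf (P (x i)) (x (Suc i))))" for n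
  proof (induction n)
    case 0
    show ?case
      using sing[of 0]
      by (subst step) (simp add: chain_step_def emeasure_pmf_single restrict_def)
  next
    case (Suc n)
    have "emeasure (chain_step \<mu> P (Suc n) x) {x (Suc n)} = ennreal (pmf (P (x n)) (x (Suc n)))"
      by (simp add: chain_step_def emeasure_pmf_single)
    then show ?case
      unfolding step[of "Suc n"] Suc.IH
      by (simp add: mult.assoc prod_nonneg flip: ennreal_mult)
  qed
  have "{\<omega>. \<forall>i\<le>n. \<omega> i = x i} = PF.emb UNIV {0..<Suc n} {restrict x {0..<Suc n}}"
    by (auto simp: prod_emb_def space_PiM fun_eq_iff restrict_def split: if_splits)
  then have "emeasure (chain \<mu> P) {\<omega>. \<forall>i\<le>n. \<omega> i = x i} = CI {0..<Suc n} {restrict x {0..<Suc n}}"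
    unfolding chain_def using lim[of "{0..<Suc n}" "{restrict x {0..<Suc n}}"] by simp
  also have "\<dots> = emeasure (C 0 (Suc n) (\<lambda>_. undefined)) {restrict x {0..<Suc n}}"
    by (subst emeasure_CI[OF subset_refl sing])
       (simp add: prod_emb_id[OF sets.sets_into_space[OF sing, unfolded space_PiM]] del: C.simps)
  finally show ?thesis
    by (simp only: emC)
qed

definition return_time :: "'s \<Rightarrow> (nat \<Rightarrow> 's) \<Rightarrow> ennreal" where
  "return_time x \<omega> = (INF n\<in>{n. 1 \<le> n \<and> \<omega> n = x}. of_nat n)"

definition positive_recurrent_kernel :: "('s \<Rightarrow> 's pmf) \<Rightarrow> bool" where
  "positive_recurrent_kernel P \<longleftrightarrow>
     (\<forall>x. (\<integral>\<^sup>+\<omega>. return_time x \<omega> \<partial>chain (return_pmf x) P) < \<infinity>)"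

definition partial_sum :: "('s \<Rightarrow> real) \<Rightarrow> nat \<Rightarrow> (nat \<Rightarrow> 's) \<Rightarrow> real" where
  "partial_sum h n \<omega> = (\<Sum>k<n. h (\<omega> k))"

definition A_seq :: "'s pmf \<Rightarrow> ('s \<Rightarrow> 's pmf) \<Rightarrow> ('s \<Rightarrow> real) \<Rightarrow> nat \<Rightarrow> real" where
  "A_seq \<pi> P h n = prob_space.variance (chain \<pi> P) (partial_sum h n) / real n"

definition autocov :: "'s pmf \<Rightarrow> ('s \<Rightarrow> 's pmf) \<Rightarrow> ('s \<Rightarrow> real) \<Rightarrow> nat \<Rightarrow> real" where
  "autocov \<pi> P h k = prob_space.expectation (chain \<pi> P) (\<lambda>\<omega>. h (\<omega> 0) * h (\<omega> k))"

definition B_seq :: "'s pmf \<Rightarrow> ('s \<Rightarrow> 's pmf) \<Rightarrow> ('s \<Rightarrow> real) \<Rightarrow> nat \<Rightarrow> real" where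
  "B_seq \<pi> P h n = autocov \<pi> P h 0 + 2 * (\<Sum>k=1..n. autocov \<pi> P h k)"

text \<open>The normal law with mean 0 and variance \<open>v \<ge> 0\<close>; for \<open>v = 0\<close> the point mass at 0.\<close>

definition centered_normal :: "real \<Rightarrow> real measure" where
  "centered_normal v =
     (if v = 0 then return borel 0 else density lborel (normal_density 0 (sqrt v)))"

definition sqrt_n_CLT :: "'s pmf \<Rightarrow> ('s \<Rightarrow> 's pmf) \<Rightarrow> ('s \<Rightarrow> real) \<Rightarrow> bool" where
  "sqrt_n_CLT \<pi> P h \<longleftrightarrow>
     (\<exists>v\<ge>0. weak_conv_m
        (\<lambda>n. distr (chain \<pi> P) borel (\<lambda>\<omega>. partial_sum h n \<omega> / sqrt (real n)))
        (centered_normal v))"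

end

theory Submission
  imports Defs "HOL-Analysis.Harmonic_Numbers" "HOL-Real_Asymp.Real_Asymp"
begin

text \<open>
  The identity \<open>n * A\<^sub>n = B\<^sub>0 + ... + B\<^bsub>n-1\<^esub>\<close> turns the problem into the classical question of a
  Fourier series with convergent Fejer means and unbounded partial sums: \<open>B\<^sub>n\<close> are the partial sums
  and \<open>A\<^sub>n\<close> the Cesaro means of the covariance series. As with Fejer's divergent series, the
  answer is to superpose polynomials whose coefficients contain, far out, a block
  \<open>1/n, ..., 1/2, 1, 0, -1, -1/2, ..., -1/n\<close>. Partial sums through half of the block reach the
  harmonic number \<open>H\<^sub>n\<close>, after the block they are back where they started, and the peak is invisible in
  the Cesaro means because it lies far to the right.

  To realise such covariances by a Markov chain, an autocorrelation is needed. The pattern of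
  \<open>fejer_pattern\<close> is antisymmetric: it has the value 1 at 0, the value -1 at \<open>2 * N\<close>, and the block
  centred at \<open>N\<close>. The correlation of the two end values with the block reproduces the
  block twice at lag \<open>N\<close>, while the correlation of the block with itself contributes only a bounded
  amount to every partial sum (\<open>sum_lag_defect_bounds\<close>): this reflects that the truncated Hilbert kernel
  \<open>1/j\<close> has a bounded Fourier transform. The result is \<open>spiky_pattern_exists\<close>.

  The chain is a flower (locale \<open>flower\<close>). From a base point it enters petal \<open>i \<ge> 1\<close> with probability
  \<open>2\<^bsup>-i\<^esup> / L\<^sub>i\<close>, runs through its \<open>L\<^sub>i\<close> states deterministically, and returns. Each
  passage carries a fair sign, and \<open>h\<close> is this sign times the suitably scaled \<open>i\<close>-th
  pattern, plus an independent fair sign \<open>\<xi>\<close> drawn afresh at each step. The signs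
  kill all correlations between different passages, so that the covariances are those of \<open>\<xi>\<close> plus
  an average of the pattern autocorrelations with weights \<open>2\<^bsup>-i\<^esup>\<close> (\<open>P_autocov\<close>). The three limits
  follow in the locale \<open>sparse_peaks\<close>: the first two by dominated convergence, the last one because the peaks are
  chosen to outgrow the weights.

  Every pattern has sum zero. Hence the part of \<open>h\<close> that comes from the petals telescopes along the
  trajectory to \<open>G(X\<^sub>n) - G(X\<^sub>0)\<close>, which is negligible after division by \<open>sqrt n\<close> by stationarity alone
  (\<open>G\<close> is not square integrable, otherwise \<open>B\<^sub>n\<close> would be bounded). What remains is a sum of
  independent signs, and the central limit theorem follows (\<open>sqrt_n_CLT_sign_plus_coboundary\<close>).

  Finally, a rotation of a cycle is a product of two reflections. The reflection of each petal onto
  itself, followed by the shifted reflection that sends the first state of a petal to the base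
  point and the base point to the first state of a random petal, is one step of the flower chain, and both
  factors are reversible. One and the same chain therefore proves both halves of the theorem.
\<close>

section \<open>Finite patterns with a high peak in their correlation sums\<close>

definition autocorr :: "(nat \<Rightarrow> real) \<Rightarrow> nat \<Rightarrow> nat \<Rightarrow> real" where
  "autocorr f L k = (\<Sum>x<L. f x * f (x + k))"

text \<open>
  For a pattern with support in \<open>{..<L}\<close> this is the \<open>m\<close>-th partial sum at 0 of the Fourier series of
  its squared absolute Fourier transform.
\<close>
definition corr_sum :: "(nat \<Rightarrow> real) \<Rightarrow> nat \<Rightarrow> nat \<Rightarrow> real" where
  "corr_sum f L m = autocorr f L 0 + 2 * (\<Sum>k=1..m. autocorr f L k)"

text \<open>Beyond the length of the pattern every pair of positions has been counted, so that the square is complete.\<close>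
lemma corr_sum_eventually_square:
  assumes f: "\<And>x. x \<ge> L \<Longrightarrow> f x = 0" and m: "m \<ge> L"
  shows "corr_sum f L m = (\<Sum>x<L. f x)\<^sup>2"
proof -
  have inner: "(\<Sum>k=1..m. f x * f (x + k)) = f x * (\<Sum>y\<in>{x<..<L}. f y)" if "x < L" for x
  proof -
    have "(\<Sum>k=1..m. f (x + k)) = (\<Sum>y\<in>{x+1..x+m}. f y)"
      by (rule sum.reindex_bij_witness[of _ "\<lambda>y. y - x" "\<lambda>k. x + k"]) auto
    also have "\<dots> = (\<Sum>y\<in>{x<..<L}. f y)"
      using m that by (intro sum.mono_neutral_right) (auto intro!: f)
    finally show ?thesis by (simp add: sum_distrib_left[symmetric])
  qed
  have square: "(\<Sum>x<K. (f x)\<^sup>2) + 2 * (\<Sum>x<K. f x * (\<Sum>y\<in>{x<..<K}. f y)) = (\<Sum>x<K. f x)\<^sup>2" for K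
  proof (induction K)
    case (Suc K)
    have "(\<Sum>y\<in>{x<..<Suc K}. f y) = (\<Sum>y\<in>{x<..<K}. f y) + f K" if "x < K" for x
    proof -
      have "{x<..<Suc K} = insert K {x<..<K}" using that by auto
      then show ?thesis by simp
    qed
    then have "(\<Sum>x<Suc K. f x * (\<Sum>y\<in>{x<..<Suc K}. f y))
      = (\<Sum>x<K. f x * (\<Sum>y\<in>{x<..<K}. f y)) + (\<Sum>x<K. f x) * f K"
      by (simp add: ring_distribs sum.distrib sum_distrib_right atLeastSucLessThan_greaterThanLessThan[symmetric])
    then show ?case using Suc by (simp add: power2_eq_square algebra_simps)
  qed simp
  have "corr_sum f L m = (\<Sum>x<L. (f x)\<^sup>2) + 2 * (\<Sum>x<L. \<Sum>k=1..m. f x * f (x + k))"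
    unfolding corr_sum_def autocorr_def
    by (subst sum.swap) (simp add: power2_eq_square)
  also have "(\<Sum>x<L. \<Sum>k=1..m. f x * f (x + k)) = (\<Sum>x<L. f x * (\<Sum>y\<in>{x<..<L}. f y))"
    by (intro sum.cong refl inner) auto
  also have "(\<Sum>x<L. (f x)\<^sup>2) + 2 * \<dots> = (\<Sum>x<L. f x)\<^sup>2"
    by (rule square)
  finally show ?thesis .
qed

text \<open>
  The estimate behind the boundedness of the self-correlation of the block. On the range \<open>a + b > n\<close> one has
  \<open>1 / (a b) = (1/a + 1/b) / (a + b) < (1/a + 1/b) / n\<close>, and exactly \<open>a\<close> values of \<open>b\<close> are
  admissible for given \<open>a\<close>, so that each of the two terms contributes 1.
\<close>
lemma sum_reciprocal_products_le:
  "(\<Sum>a=1..n. \<Sum>b\<in>{b\<in>{1..n}. a + b > n}. 1 / (real a * real b)) \<le> 2" (is "?U \<le> 2")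
proof (cases "n = 0")
  case False
  let ?S = "\<lambda>a. {b\<in>{1..n}. a + b > n}"
  have card: "card (?S a) = a" if "a \<in> {1..n}" for a
  proof -
    have "?S a = {n-a<..n}" using that by auto
    then show ?thesis using that by simp
  qed
  have pt: "1 / (real a * real b) \<le> (1 / real n) * (1 / real a + 1 / real b)"
    if "a \<in> {1..n}" "b \<in> ?S a" for a b
  proof -
    have "real n \<le> real a + real b" using that by auto
    moreover have "a > 0" "b > 0" "n > 0" using that by auto
    ultimately show ?thesis by (simp add: field_simps)
  qed
  have "?U \<le> (\<Sum>a=1..n. \<Sum>b\<in>?S a. (1 / real n) * (1 / real a + 1 / real b))"
    by (intro sum_mono pt) auto
  also have "\<dots> = (1 / real n) * ((\<Sum>a=1..n. \<Sum>b\<in>?S a. 1 / real a) + (\<Sum>a=1..n. \<Sum>b\<in>?S a. 1 / real b))"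
    by (simp only: sum_distrib_left[symmetric] sum.distrib)
  also have "(\<Sum>a=1..n. \<Sum>b\<in>?S a. 1 / real b) = (\<Sum>a=1..n. \<Sum>b\<in>?S a. 1 / real a)"
    by (subst sum.swap_restrict) (auto simp: add.commute)
  also have "(\<Sum>a=1..n. \<Sum>b\<in>?S a. 1 / real a) = (\<Sum>a=1..n. 1)"
  proof (intro sum.cong refl)
    fix a assume a: "a \<in> {1..n}"
    show "(\<Sum>b\<in>?S a. 1 / real a) = 1"
      by (simp only: sum_constant card[OF a]) (use a in simp)
  qed
  finally show ?thesis using False by simp
qed simp

lemma sum_inverse_squares_le: "(\<Sum>k=1..m. 1 / (real k)\<^sup>2) \<le> 2"
proof -
  have "(\<Sum>k=1..m. 1 / (real k)\<^sup>2) \<le> 2 - 1 / real m" if "m > 0"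
    using that
  proof (induction m rule: nat_induct_non_zero)
    case (Suc m)
    have "1 / (real (Suc m))\<^sup>2 \<le> 1 / real m - 1 / real (Suc m)"
    proof -
      have "1 / real m - 1 / real (Suc m) = 1 / (real m * real (Suc m))"
        using Suc.hyps by (simp add: field_simps)
      then show ?thesis
        using Suc.hyps by (auto simp: power2_eq_square intro!: divide_left_mono mult_right_mono)
    qed
    then show ?case using Suc.IH by simp
  qed simp
  then show ?thesis by (cases "m = 0") (auto intro: order_trans)
qed

definition truncated_reciprocal :: "nat \<Rightarrow> nat \<Rightarrow> real" where
  "truncated_reciprocal n a = (if a \<le> n then 1 / real a else 0)"

lemma partial_fraction_same:
  assumes "a > 0" "k > 0"
  shows "1 / (real a * (real a + real k)) = (1 / real a - 1 / (real a + real k)) / real k"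
  using assms by (simp add: divide_simps)

lemma partial_fraction_opposite:
  assumes "a > 0" "a < k"
  shows "1 / (real a * (real k - real a)) = (1 / real a + 1 / (real k - real a)) / real k"
  using assms by (simp add: divide_simps)

text \<open>The sum over pairs at distance \<open>k\<close> that lie on the same side of the centre, by partial fractions.\<close>
lemma same_side_sum:
  assumes k: "k \<in> {1..n}"
  shows "(\<Sum>a\<le>n. truncated_reciprocal n a * truncated_reciprocal n (a + k)) = (harm k - (harm n - harm (n - k))) / real k"
proof -
  have "(\<Sum>a\<le>n. truncated_reciprocal n a * truncated_reciprocal n (a + k)) = (\<Sum>a=1..n-k. (1 / real a - 1 / real (a + k)) / real k)"
    using k by (intro sum.mono_neutral_cong_right)
      (auto simp: truncated_reciprocal_def partial_fraction_same)
  also have "\<dots> = (harm (n - k) - (\<Sum>a=1..n-k. 1 / real (a + k))) / real k"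
    by (simp add: sum_divide_distrib[symmetric] sum_subtractf harm_def inverse_eq_divide)
  also have "(\<Sum>a=1..n-k. 1 / real (a + k)) = (\<Sum>l\<in>{k<..n}. 1 / real l)"
    using k by (intro sum.reindex_bij_witness[of _ "\<lambda>y. y - k" "\<lambda>a. a + k"]) auto
  also have "\<dots> = harm n - harm k"
  proof -
    have "{1..n} = {1..k} \<union> {k<..n}" using k by auto
    then have "harm n = harm k + (\<Sum>l\<in>{k<..n}. 1 / real l)"
      by (simp add: harm_def sum.union_disjoint inverse_eq_divide ivl_disj_int)
    then show ?thesis by simp
  qed
  finally show ?thesis by (simp add: algebra_simps)
qed

text \<open>The sum over pairs at distance \<open>k\<close> that lie on opposite sides of the centre.\<close>
lemma opposite_side_sum:
  assumes k: "k \<in> {1..n}"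
  shows "(\<Sum>a\<le>k. truncated_reciprocal n a * truncated_reciprocal n (k - a)) = 2 * (harm k - 1 / real k) / real k"
proof -
  have "(\<Sum>a\<le>k. truncated_reciprocal n a * truncated_reciprocal n (k - a)) = (\<Sum>a=1..k-1. (1 / real a + 1 / real (k - a)) / real k)"
    using k by (intro sum.mono_neutral_cong_right)
      (auto simp: truncated_reciprocal_def of_nat_diff partial_fraction_opposite)
  also have "\<dots> = ((\<Sum>a=1..k-1. 1 / real a) + (\<Sum>a=1..k-1. 1 / real (k - a))) / real k"
    by (simp add: sum_divide_distrib[symmetric] sum.distrib)
  also have "(\<Sum>a=1..k-1. 1 / real (k - a)) = (\<Sum>a=1..k-1. 1 / real a)"
    by (rule sum.reindex_bij_witness[of _ "\<lambda>y. k - y" "\<lambda>y. k - y"]) auto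
  also have "(\<Sum>a=1..k-1. 1 / real a) = harm k - 1 / real k"
    using k by (cases k) (auto simp: harm_def inverse_eq_divide)
  finally show ?thesis by simp
qed

text \<open>Each summand is a row of the double sum in \<open>sum_reciprocal_products_le\<close>.\<close>
lemma harm_tail_sum_le:
  assumes "m \<le> n"
  shows "(\<Sum>k=1..m. (harm n - harm (n - k)) / real k) \<le> 2"
    and "0 \<le> (\<Sum>k=1..m. (harm n - harm (n - k)) / real k)"
proof -
  have eq: "(harm n - harm (n - k)) / real k = (\<Sum>b\<in>{b\<in>{1..n}. k + b > n}. 1 / (real k * real b))"
    if "k \<in> {1..n}" for k
  proof -
    define T where "T = {b\<in>{1..n}. k + b > n}"
    have "{1..n} = {1..n-k} \<union> T" using that by (auto simp: T_def)
    moreover have "sum (\<lambda>l. 1 / real l) ({1..n-k} \<union> T)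
      = sum (\<lambda>l. 1 / real l) {1..n-k} + sum (\<lambda>l. 1 / real l) T"
      by (intro sum.union_disjoint) (auto simp: T_def)
    ultimately have "harm n = harm (n-k) + (\<Sum>b\<in>T. 1 / real b)"
      by (simp add: harm_def inverse_eq_divide)
    then show ?thesis unfolding T_def[symmetric]
      by (simp add: sum_divide_distrib mult.commute)
  qed
  have "(\<Sum>k=1..m. (harm n - harm (n - k)) / real k)
      = (\<Sum>k=1..m. \<Sum>b\<in>{b\<in>{1..n}. k + b > n}. 1 / (real k * real b))"
    using assms by (intro sum.cong eq) auto
  also have "\<dots> \<le> (\<Sum>k=1..n. \<Sum>b\<in>{b\<in>{1..n}. k + b > n}. 1 / (real k * real b))"
    using assms by (intro sum_mono2) (auto intro!: sum_nonneg)
  finally show "(\<Sum>k=1..m. (harm n - harm (n - k)) / real k) \<le> 2"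
    using sum_reciprocal_products_le[of n] by linarith
  show "0 \<le> (\<Sum>k=1..m. (harm n - harm (n - k)) / real k)"
    by (intro sum_nonneg divide_nonneg_nonneg) (auto intro!: harm_mono)
qed

lemma opposite_side_tail_le:
  "(\<Sum>k\<in>{n<..m}. \<Sum>a\<le>k. truncated_reciprocal n a * truncated_reciprocal n (k - a)) \<le> 2"
proof -
  have "(\<Sum>k\<in>{n<..m}. \<Sum>a\<le>k. truncated_reciprocal n a * truncated_reciprocal n (k - a))
     = (\<Sum>k\<in>{n<..m}. \<Sum>a=1..n. truncated_reciprocal n a * truncated_reciprocal n (k - a))"
    by (intro sum.cong refl sum.mono_neutral_right) (auto simp: truncated_reciprocal_def)
  also have "\<dots> = (\<Sum>a=1..n. \<Sum>k\<in>{n<..m}. truncated_reciprocal n a * truncated_reciprocal n (k - a))"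
    by (rule sum.swap)
  also have "\<dots> \<le> (\<Sum>a=1..n. \<Sum>b\<in>{b\<in>{1..n}. a + b > n}. 1 / (real a * real b))"
  proof (rule sum_mono)
    fix a assume a: "a \<in> {1..n}"
    have "(\<Sum>k\<in>{n<..m}. truncated_reciprocal n a * truncated_reciprocal n (k - a)) = (\<Sum>b\<in>{n-a<..m-a}. truncated_reciprocal n a * truncated_reciprocal n b)"
      using a by (intro sum.reindex_bij_witness[of _ "\<lambda>b. b + a" "\<lambda>k. k - a"]) auto
    also have "\<dots> = (\<Sum>b\<in>{n-a<..m-a} \<inter> {1..n}. 1 / (real a * real b))"
      using a by (intro sum.mono_neutral_cong_right) (auto simp: truncated_reciprocal_def)
    also have "\<dots> \<le> (\<Sum>b\<in>{b\<in>{1..n}. a + b > n}. 1 / (real a * real b))"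
      by (intro sum_mono2) auto
    finally show "(\<Sum>k\<in>{n<..m}. truncated_reciprocal n a * truncated_reciprocal n (k - a))
       \<le> (\<Sum>b\<in>{b\<in>{1..n}. a + b > n}. 1 / (real a * real b))" .
  qed
  also have "\<dots> \<le> 2" by (rule sum_reciprocal_products_le)
  finally show ?thesis .
qed

text \<open>
  The correlation of the block with itself at lag \<open>k\<close>: pairs on the same side of the centre
  (twice, by symmetry) count positively, pairs on opposite sides negatively.
\<close>
definition lag_defect :: "nat \<Rightarrow> nat \<Rightarrow> real" where
  "lag_defect n k = 2 * (\<Sum>a\<le>n. truncated_reciprocal n a * truncated_reciprocal n (a + k)) - (\<Sum>a\<le>k. truncated_reciprocal n a * truncated_reciprocal n (k - a))"

text \<open>
  The logarithmic terms \<open>harm k / k\<close> of the two contributions cancel. This is where the odd symmetry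
  of the block is used: each contribution alone has unbounded sums.
\<close>
lemma lag_defect_near:
  assumes "k \<in> {1..n}"
  shows "lag_defect n k = 2 / (real k)\<^sup>2 - 2 * ((harm n - harm (n - k)) / real k)"
  using assms unfolding lag_defect_def same_side_sum[OF assms] opposite_side_sum[OF assms]
  by (simp add: field_simps power2_eq_square)

lemma lag_defect_far:
  assumes "k > n"
  shows "lag_defect n k = - (\<Sum>a\<le>k. truncated_reciprocal n a * truncated_reciprocal n (k - a))"
  using assms by (auto simp: lag_defect_def truncated_reciprocal_def intro!: sum.neutral)

text \<open>
  Lags up to \<open>n\<close> are governed by a convergent series and the double sum above; at larger lags only pairs
  on opposite sides remain, and these are counted by the same double sum.
\<close>
lemma sum_lag_defect_bounds:
  "- 6 \<le> (\<Sum>k=1..m. lag_defect n k) \<and> (\<Sum>k=1..m. lag_defect n k) \<le> 4"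
proof -
  let ?p = "min m n"
  have nonneg: "truncated_reciprocal n a \<ge> 0" for a by (simp add: truncated_reciprocal_def)
  have "sum (lag_defect n) ({1..?p} \<union> {n<..m}) = (\<Sum>k=1..?p. lag_defect n k) + (\<Sum>k\<in>{n<..m}. lag_defect n k)"
    by (rule sum.union_disjoint) auto
  also have "{1..?p} \<union> {n<..m} = {1..m}" by auto
  finally have "(\<Sum>k=1..m. lag_defect n k) = (\<Sum>k=1..?p. lag_defect n k) + (\<Sum>k\<in>{n<..m}. lag_defect n k)" .
  also have "(\<Sum>k=1..?p. lag_defect n k) = 2 * (\<Sum>k=1..?p. 1 / (real k)\<^sup>2) - 2 * (\<Sum>k=1..?p. (harm n - harm (n - k)) / real k)"
    unfolding sum_distrib_left sum_subtractf[symmetric]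
    by (intro sum.cong refl) (subst lag_defect_near; simp)
  also have "(\<Sum>k\<in>{n<..m}. lag_defect n k) = - (\<Sum>k\<in>{n<..m}. \<Sum>a\<le>k. truncated_reciprocal n a * truncated_reciprocal n (k - a))"
    by (simp only: sum_negf[symmetric]) (intro sum.cong refl, simp add: lag_defect_far sum_negf)
  finally have eq: "(\<Sum>k=1..m. lag_defect n k) = 2 * (\<Sum>k=1..?p. 1 / (real k)\<^sup>2) - 2 * (\<Sum>k=1..?p. (harm n - harm (n - k)) / real k)
      - (\<Sum>k\<in>{n<..m}. \<Sum>a\<le>k. truncated_reciprocal n a * truncated_reciprocal n (k - a))" by simp
  have "(\<Sum>k=1..?p. 1 / (real k)\<^sup>2) \<ge> 0" by (intro sum_nonneg) auto
  moreover have "(\<Sum>k\<in>{n<..m}. \<Sum>a\<le>k. truncated_reciprocal n a * truncated_reciprocal n (k - a)) \<ge> 0"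
    by (intro sum_nonneg mult_nonneg_nonneg nonneg)
  ultimately show ?thesis
    using eq sum_inverse_squares_le[of ?p] harm_tail_sum_le[of ?p n] opposite_side_tail_le[of n m]
    by simp
qed

text \<open>The function \<open>-1/(x - N)\<close> cut off at distance \<open>n\<close> from \<open>N\<close>; at \<open>x = N\<close> division by zero gives the value 0.\<close>
definition hilbert_burst :: "nat \<Rightarrow> nat \<Rightarrow> nat \<Rightarrow> real" where
  "hilbert_burst n N x = (if x < N then truncated_reciprocal n (N - x) else - truncated_reciprocal n (x - N))"

lemma autocorr_hilbert_burst:
  assumes N: "n < N"
  shows "autocorr (hilbert_burst n N) (2 * N + 1) k = lag_defect n k"
proof -
  let ?r = "hilbert_burst n N" and ?w = "truncated_reciprocal n"
  have w0: "?w a = 0" if "a > n" for a using that by (simp add: truncated_reciprocal_def)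
  have right: "(\<Sum>x\<in>{N..2*N}. ?r x * ?r (x + k)) = (\<Sum>a\<le>n. ?w a * ?w (a + k))"
  proof -
    have "(\<Sum>x\<in>{N..2*N}. ?r x * ?r (x + k)) = (\<Sum>a\<le>N. ?w a * ?w (a + k))"
      by (rule sum.reindex_bij_witness[of _ "\<lambda>a. a + N" "\<lambda>x. x - N"]) (auto simp: hilbert_burst_def)
    also have "\<dots> = (\<Sum>a\<le>n. ?w a * ?w (a + k))"
      using N by (intro sum.mono_neutral_right) (auto simp: w0)
    finally show ?thesis .
  qed
  have left: "(\<Sum>x<N. ?r x * ?r (x + k)) = (\<Sum>a\<le>n. ?w a * ?w (a + k)) - (\<Sum>a\<le>k. ?w a * ?w (k - a))"
  proof -
    have "(\<Sum>x<N. ?r x * ?r (x + k)) = (\<Sum>a=1..N. ?w a * (if k < a then ?w (a - k) else - ?w (k - a)))"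
      by (rule sum.reindex_bij_witness[of _ "\<lambda>a. N - a" "\<lambda>x. N - x"]) (auto simp: hilbert_burst_def add.commute)
    also have "\<dots> = (\<Sum>a\<le>N+k. ?w a * (if k < a then ?w (a - k) else - ?w (k - a)))"
      using N by (intro sum.mono_neutral_left) (auto simp: w0, auto simp: truncated_reciprocal_def)
    also have "\<dots> = (\<Sum>a\<in>{..N+k} \<inter> {a. k < a}. ?w a * ?w (a - k)) + (\<Sum>a\<in>{..N+k} \<inter> - {a. k < a}. - (?w a * ?w (k - a)))"
      by (subst sum.If_cases[symmetric]) (auto intro!: sum.cong)
    also have "{..N+k} \<inter> - {a. k < a} = {..k}" by auto
    also have "(\<Sum>a\<in>{..N+k} \<inter> {a. k < a}. ?w a * ?w (a - k)) = (\<Sum>b=1..N. ?w (b + k) * ?w b)"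
      by (rule sum.reindex_bij_witness[of _ "\<lambda>b. b + k" "\<lambda>a. a - k"]) auto
    also have "\<dots> = (\<Sum>b\<le>N. ?w b * ?w (b + k))"
      by (intro sum.mono_neutral_cong_left) (auto, auto simp: truncated_reciprocal_def)
    also have "\<dots> = (\<Sum>a\<le>n. ?w a * ?w (a + k))"
      using N by (intro sum.mono_neutral_right) (auto simp: w0)
    finally show ?thesis by (simp add: sum_negf)
  qed
  have split: "{..<2 * N + 1} = {..<N} \<union> {N..2*N}" by auto
  have "autocorr ?r (2 * N + 1) k = (\<Sum>x<N. ?r x * ?r (x + k)) + (\<Sum>x\<in>{N..2*N}. ?r x * ?r (x + k))"
    unfolding autocorr_def split by (rule sum.union_disjoint) auto
  then show ?thesis unfolding left right lag_defect_def by linarith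
qed

text \<open>The two end values make the pattern odd about \<open>N\<close>, hence of sum zero, and correlate with the block.\<close>
definition fejer_pattern :: "nat \<Rightarrow> nat \<Rightarrow> nat \<Rightarrow> real" where
  "fejer_pattern n N x = of_bool (x = 0) - of_bool (x = 2 * N) + hilbert_burst n N x"

text \<open>
  The left end value meets the block at lags around \<open>N\<close>; by oddness the right end value meets it
  with the same result, whence the factor 2 in front of the block.
\<close>
lemma autocorr_fejer_pattern:
  assumes N: "n < N"
  shows "autocorr (fejer_pattern n N) (2 * N + 1) k
    = 2 * of_bool (k = 0) - of_bool (k = 2 * N) + 2 * hilbert_burst n N k + lag_defect n k"
proof -
  let ?r = "hilbert_burst n N" and ?f = "fejer_pattern n N" and ?I = "{..<2*N+1}"
  have r0: "?r x = 0" if "x \<ge> 2 * N" for x using that N by (auto simp: hilbert_burst_def truncated_reciprocal_def)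
  have r00: "?r 0 = 0" using N by (auto simp: hilbert_burst_def truncated_reciprocal_def)
  have refl: "?r (2 * N - k) = - ?r k" if "k \<le> 2 * N"
  proof -
    have "2 * N - k < N \<longleftrightarrow> N < k" using that N by auto
    moreover have "N - (2 * N - k) = k - N" "N > k \<Longrightarrow> 2 * N - k - N = N - k" using that by auto
    ultimately show ?thesis using that by (auto simp: hilbert_burst_def truncated_reciprocal_def not_less)
  qed
  have "autocorr ?f (2 * N + 1) k
    = (\<Sum>x\<in>?I. if x = 0 then ?f (x + k) else 0) - (\<Sum>x\<in>?I. if x = 2 * N then ?f (x + k) else 0)
      + (\<Sum>x\<in>?I. ?r x * ?f (x + k))"
    unfolding autocorr_def sum.distrib[symmetric] sum_subtractf[symmetric]
    by (intro sum.cong refl) (auto simp: fejer_pattern_def algebra_simps)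
  also have "\<dots> = ?f k - ?f (2 * N + k) + (\<Sum>x\<in>?I. ?r x * ?f (x + k))"
    by simp
  also have "(\<Sum>x\<in>?I. ?r x * ?f (x + k)) = - (\<Sum>x\<in>?I. ?r x * of_bool (x + k = 2 * N)) + autocorr ?r (2 * N + 1) k"
    unfolding autocorr_def sum.distrib[symmetric] sum_negf[symmetric]
    by (intro sum.cong refl) (use r00 in \<open>auto simp: fejer_pattern_def algebra_simps intro!: Nat.gr0I\<close>)
  also have "(\<Sum>x\<in>?I. ?r x * of_bool (x + k = 2 * N)) = - ?r k"
  proof (cases "k \<le> 2 * N")
    case True
    have "(\<Sum>x\<in>?I. ?r x * of_bool (x + k = 2 * N)) = (\<Sum>x\<in>?I. if x = 2 * N - k then ?r x else 0)"
      using True by (intro sum.cong) auto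
    also have "\<dots> = ?r (2 * N - k)" by (subst sum.delta) auto
    finally show ?thesis using refl[OF True] by simp
  next
    case False
    then show ?thesis using r0[of k] by (auto intro!: sum.neutral)
  qed
  also have "?f (2 * N + k) = - of_bool (k = 0)"
    using r0[of "2 * N + k"] N by (simp add: fejer_pattern_def)
  also have "?f k = of_bool (k = 0) - of_bool (k = 2 * N) + ?r k"
    by (simp add: fejer_pattern_def)
  finally show ?thesis
    unfolding autocorr_hilbert_burst[OF N] by simp
qed

definition truncated_reciprocal_sum :: "nat \<Rightarrow> nat \<Rightarrow> real" where
  "truncated_reciprocal_sum n d = (\<Sum>a\<le>d. truncated_reciprocal n a)"

lemma truncated_reciprocal_sum_eq_harm: "d \<ge> n \<Longrightarrow> truncated_reciprocal_sum n d = harm n"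
  unfolding truncated_reciprocal_sum_def harm_def
  by (intro sum.mono_neutral_cong_right) (auto simp: truncated_reciprocal_def inverse_eq_divide)

lemma truncated_reciprocal_sum_nonneg: "truncated_reciprocal_sum n d \<ge> 0"
  unfolding truncated_reciprocal_sum_def by (intro sum_nonneg) (simp add: truncated_reciprocal_def)

lemma truncated_reciprocal_sum_le: "truncated_reciprocal_sum n d \<le> harm n"
proof -
  have "truncated_reciprocal_sum n d \<le> truncated_reciprocal_sum n (d + n)"
    unfolding truncated_reciprocal_sum_def by (intro sum_mono2) (auto simp: truncated_reciprocal_def)
  then show ?thesis by (simp add: truncated_reciprocal_sum_eq_harm)
qed

lemma truncated_reciprocal_sum_0: "truncated_reciprocal_sum n 0 = 0"
  by (simp add: truncated_reciprocal_sum_def truncated_reciprocal_def)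

text \<open>
  Moving through the block from the left, the partial sums increase to \<open>harm n\<close> just before the
  centre, and decrease symmetrically afterwards.
\<close>
definition burst_sum :: "nat \<Rightarrow> nat \<Rightarrow> nat \<Rightarrow> real" where
  "burst_sum n N m = harm n - truncated_reciprocal_sum n (if m < N then N - 1 - m else m - N)"

lemma burst_sum_nonneg: "burst_sum n N m \<ge> 0"
  by (simp add: burst_sum_def truncated_reciprocal_sum_le)

lemma sum_hilbert_burst:
  assumes N: "n < N"
  shows "(\<Sum>k=1..m. hilbert_burst n N k) = burst_sum n N m"
proof (induction m)
  case 0
  have "n \<le> N - 1" using N by simp
  then show ?case using N by (simp add: burst_sum_def truncated_reciprocal_sum_eq_harm)
next
  case (Suc m)
  have step: "truncated_reciprocal_sum n (Suc d) = truncated_reciprocal_sum n d + truncated_reciprocal n (Suc d)" for d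
    by (simp add: truncated_reciprocal_sum_def)
  have S: "(\<Sum>k=1..Suc m. hilbert_burst n N k) = burst_sum n N m + hilbert_burst n N (Suc m)"
    using Suc by simp
  consider (left) d where "N = Suc (Suc m) + d" | (mid) "N = Suc m" | (right) d where "m = N + d"
  proof (cases "N \<le> m")
    case True
    then show ?thesis using right[of "m - N"] by simp
  next
    case False
    then show ?thesis using mid left[of "N - Suc (Suc m)"] by linarith
  qed
  then show ?case
  proof cases
    case left
    then show ?thesis unfolding S by (simp add: burst_sum_def hilbert_burst_def step)
  next
    case mid
    then show ?thesis unfolding S by (simp add: burst_sum_def hilbert_burst_def truncated_reciprocal_def)
  next
    case right
    then show ?thesis unfolding S by (simp add: burst_sum_def hilbert_burst_def step)
  qed
qed

lemma corr_sum_fejer_pattern: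
  assumes N: "n < N"
  shows "corr_sum (fejer_pattern n N) (2 * N + 1) m =
    2 - 2 * of_bool (2 * N \<le> m) + 4 * burst_sum n N m
    + lag_defect n 0 + 2 * (\<Sum>k=1..m. lag_defect n k)"
proof -
  have "(\<Sum>k=1..m. of_bool (k = 2 * N)) = (of_bool (2 * N \<le> m) :: real)"
    using N by (simp add: of_bool_def)
  moreover have "hilbert_burst n N 0 = 0"
    using N by (simp add: hilbert_burst_def truncated_reciprocal_def)
  ultimately show ?thesis
    using N by (simp only: corr_sum_def autocorr_fejer_pattern[OF N] sum.distrib sum_subtractf
      sum_distrib_left[symmetric] sum_hilbert_burst[OF N]) simp
qed

lemma lag_defect_0_bounds: "0 \<le> lag_defect n 0" "lag_defect n 0 \<le> 4"
proof -
  have "lag_defect n 0 = 2 * (\<Sum>a=1..n. 1 / (real a)\<^sup>2)"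
    unfolding lag_defect_def
    by (subst sum.mono_neutral_cong_right[of "{..n}" "{1..n}" _ "\<lambda>a. 1 / (real a)\<^sup>2"])
       (auto simp: truncated_reciprocal_def power2_eq_square)
  then show "0 \<le> lag_defect n 0" "lag_defect n 0 \<le> 4"
    using sum_inverse_squares_le[of n] by (auto intro!: sum_nonneg)
qed

text \<open>
  The peak has height at most \<open>n\<close> and width \<open>2 * n\<close>. Since it begins after more than \<open>2 * n\<^sup>2\<close> steps, its
  total mass is never more than the number of steps made so far.
\<close>
lemma fejer_pattern_Cesaro:
  assumes N: "N = 2 * n ^ 2 + n + 1"
  shows "(\<Sum>m<T. corr_sum (fejer_pattern n N) (2 * N + 1) m) \<le> 18 * real T"
proof -
  let ?Q = "burst_sum n N"
  have "n < N" using N by simp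
  have Q_le: "?Q m \<le> (if N - n \<le> m \<and> m < N + n then real n else 0)" for m
  proof -
    define d where "d = (if m < N then N - 1 - m else m - N)"
    have Q_eq: "?Q m = harm n - truncated_reciprocal_sum n d" by (simp add: burst_sum_def d_def)
    show ?thesis
    proof (cases "N - n \<le> m \<and> m < N + n")
      case True
      have "harm n \<le> (real n)"
        unfolding harm_def using sum_mono[of "{1..n}" "\<lambda>k. inverse (real k)" "\<lambda>_. 1"]
        by (auto simp: inverse_le_1_iff)
      then show ?thesis using True truncated_reciprocal_sum_nonneg[of n d] unfolding Q_eq by simp
    next
      case False
      then have "n \<le> d" using \<open>n < N\<close> unfolding d_def by (cases "m < N"; simp; linarith)
      then show ?thesis unfolding Q_eq using False by (simp add: truncated_reciprocal_sum_eq_harm)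
    qed
  qed
  have "(\<Sum>m<T. ?Q m) \<le> (\<Sum>m<T. if N - n \<le> m \<and> m < N + n then real n else 0)"
    by (intro sum_mono Q_le)
  also have "\<dots> = (\<Sum>m\<in>{..<T} \<inter> {N-n..<N+n}. real n)"
    by (subst sum.inter_restrict) (auto intro!: sum.cong)
  also have "\<dots> \<le> real T"
  proof (cases "T \<le> N - n")
    case True
    then have "{..<T} \<inter> {N-n..<N+n} = {}" by auto
    then show ?thesis by simp
  next
    case False
    have "card ({..<T} \<inter> {N-n..<N+n}) \<le> card {N-n..<N+n}" by (intro card_mono) auto
    also have "\<dots> = 2 * n" using \<open>n < N\<close> by simp
    finally have "(\<Sum>m\<in>{..<T} \<inter> {N-n..<N+n}. real n) \<le> real (2 * n) * real n"
      unfolding sum_constant by (intro mult_right_mono) (simp_all only: of_nat_le_iff of_nat_0_le_iff)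
    also have "\<dots> \<le> real T"
    proof -
      have "2 * n * n \<le> T" using False N by (simp add: power2_eq_square)
      then show ?thesis by (metis of_nat_le_iff of_nat_mult)
    qed
    finally show ?thesis .
  qed
  finally have Q: "(\<Sum>m<T. ?Q m) \<le> real T" .
  have "corr_sum (fejer_pattern n N) (2 * N + 1) m \<le> 14 + 4 * ?Q m" for m
    unfolding corr_sum_fejer_pattern[OF \<open>n < N\<close>]
    using lag_defect_0_bounds[of n] sum_lag_defect_bounds[of n m] by simp
  then have "(\<Sum>m<T. corr_sum (fejer_pattern n N) (2 * N + 1) m) \<le> (\<Sum>m<T. 14 + 4 * ?Q m)"
    by (intro sum_mono)
  also have "\<dots> = 14 * real T + 4 * (\<Sum>m<T. ?Q m)" by (simp only: sum.distrib sum_distrib_left[symmetric]) simp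
  finally show ?thesis using Q by linarith
qed

text \<open>
  The point is that the bound 18 does not depend on the height \<open>K\<close> of the peak.
\<close>
lemma spiky_pattern_exists:
  "\<exists>f L. L \<ge> 2 \<and> (\<forall>x\<ge>L. f x = 0) \<and> (\<Sum>x<L. f x) = 0 \<and>
     (\<forall>m. corr_sum f L m \<ge> - 18) \<and> (\<forall>T. (\<Sum>m<T. corr_sum f L m) \<le> 18 * real T) \<and>
     (\<exists>m. corr_sum f L m \<ge> K)"
proof -
  obtain n :: nat where n: "harm n \<ge> (K + 18) / 4"
  proof -
    have "eventually (\<lambda>n. (K + 18) / 4 \<le> harm n) sequentially"
      using harm_at_top by (simp only: filterlim_at_top)
    then show ?thesis using that by (auto simp only: eventually_sequentially)
  qed
  \<comment> \<open>Far enough to the right for \<open>fejer_pattern_Cesaro\<close>.\<close>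
  define N where "N = 2 * n ^ 2 + n + 1"
  have nN: "n < N" by (simp add: N_def)
  let ?f = "fejer_pattern n N" and ?L = "2 * N + 1"
  have low: "corr_sum ?f ?L m \<ge> 4 * burst_sum n N m - 18" for m
    unfolding corr_sum_fejer_pattern[OF nN]
    using lag_defect_0_bounds[of n] sum_lag_defect_bounds[of n m] by (simp add: of_bool_def)
  have zero: "(\<Sum>x<?L. ?f x) = 0"
  proof -
    have "(\<Sum>x<?L. ?f x) = (\<Sum>x<?L. if x = 0 then 1 else 0) - (\<Sum>x<?L. if x = 2 * N then 1 else 0)
      + (\<Sum>x<?L. hilbert_burst n N x)"
      unfolding fejer_pattern_def sum.distrib[symmetric] sum_subtractf[symmetric] by (intro sum.cong) auto
    also have "(\<Sum>x<?L. hilbert_burst n N x) = (\<Sum>k=1..2*N. hilbert_burst n N k)"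
      using nN by (intro sum.mono_neutral_right) (auto simp: hilbert_burst_def truncated_reciprocal_def)
    also have "\<dots> = 0" unfolding sum_hilbert_burst[OF nN] using nN by (simp add: burst_sum_def truncated_reciprocal_sum_eq_harm)
    finally show ?thesis by simp
  qed
  show ?thesis
  proof (rule exI[of _ ?f], rule exI[of _ ?L], intro exI[of _ "N - 1"] conjI allI impI)
    show "2 \<le> ?L" using nN by simp
    show "?f x = 0" if "x \<ge> ?L" for x
      using that nN by (auto simp: fejer_pattern_def hilbert_burst_def truncated_reciprocal_def)
    show "corr_sum ?f ?L m \<ge> - 18" for m using low[of m] burst_sum_nonneg[of n N m] by linarith
    show "corr_sum ?f ?L (N - 1) \<ge> K"
      using low[of "N - 1"] n nN by (simp add: burst_sum_def truncated_reciprocal_sum_0)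
  qed (use zero fejer_pattern_Cesaro[OF N_def] in auto)
qed

section \<open>Iterated expectations and path laws\<close>

lemma integral_bind_pmf_real:
  fixes f :: "'b \<Rightarrow> real"
  assumes f: "integrable (measure_pmf (bind_pmf p q)) f"
  shows integrable_bind_pmf_kernel: "x \<in> set_pmf p \<Longrightarrow> integrable (measure_pmf (q x)) f"
    and integrable_bind_pmf_inner: "integrable (measure_pmf p) (\<lambda>x. \<integral>y. f y \<partial>q x)"
    and integral_bind_pmf_iterated: "(\<integral>y. f y \<partial>bind_pmf p q) = (\<integral>x. \<integral>y. f y \<partial>q x \<partial>p)"
proof -
  have kernel: "integrable (measure_pmf (q x)) g"
    if g: "integrable (measure_pmf (bind_pmf p q)) g" and x: "x \<in> set_pmf p" for g :: "'b \<Rightarrow> real" and x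
  proof -
    have "(\<integral>\<^sup>+x. (\<integral>\<^sup>+y. norm (g y) \<partial>q x) \<partial>p) < \<infinity>"
      using g by (simp add: integrable_iff_bounded)
    then have "AE x in p. (\<integral>\<^sup>+y. norm (g y) \<partial>q x) \<noteq> \<infinity>"
      by (intro nn_integral_PInf_AE) (auto simp: less_top)
    then have "(\<integral>\<^sup>+y. norm (g y) \<partial>q x) \<noteq> \<infinity>" using x by (simp add: AE_measure_pmf_iff)
    then show ?thesis by (simp add: integrable_iff_bounded less_top)
  qed
  have pos: "integrable (measure_pmf p) (\<lambda>x. \<integral>y. g y \<partial>q x) \<and> (\<integral>y. g y \<partial>bind_pmf p q) = (\<integral>x. \<integral>y. g y \<partial>q x \<partial>p)"
    if g: "integrable (measure_pmf (bind_pmf p q)) g" and nn: "\<And>y. g y \<ge> 0" for g :: "'b \<Rightarrow> real"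
  proof -
    have "(\<integral>\<^sup>+x. ennreal (\<integral>y. g y \<partial>q x) \<partial>p) = (\<integral>\<^sup>+x. (\<integral>\<^sup>+y. g y \<partial>q x) \<partial>p)"
      using kernel[OF g] nn
      by (intro nn_integral_cong_AE) (simp add: AE_measure_pmf_iff nn_integral_eq_integral)
    also have "\<dots> = (\<integral>\<^sup>+y. g y \<partial>bind_pmf p q)" by simp
    also have "\<dots> = ennreal (\<integral>y. g y \<partial>bind_pmf p q)"
      using g nn by (intro nn_integral_eq_integral) auto
    finally have eq: "(\<integral>\<^sup>+x. ennreal (\<integral>y. g y \<partial>q x) \<partial>p) = ennreal (\<integral>y. g y \<partial>bind_pmf p q)" .
    have int: "integrable (measure_pmf p) (\<lambda>x. \<integral>y. g y \<partial>q x)"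
      using eq nn by (intro integrableI_nonneg) auto
    have "ennreal (\<integral>x. \<integral>y. g y \<partial>q x \<partial>p) = ennreal (\<integral>y. g y \<partial>bind_pmf p q)"
      using nn_integral_eq_integral[OF int] nn eq by auto
    then show ?thesis using int nn by (auto simp: integral_nonneg_AE)
  qed
  let ?P = "\<lambda>y. max 0 (f y)" and ?N = "\<lambda>y. max 0 (- f y)"
  have P: "integrable (measure_pmf (bind_pmf p q)) ?P" and N: "integrable (measure_pmf (bind_pmf p q)) ?N"
    using f by auto
  have f_eq: "f = (\<lambda>y. ?P y - ?N y)" by (auto simp: max_def)
  show k: "integrable (measure_pmf (q x)) f" if "x \<in> set_pmf p" for x using kernel[OF f that] .
  have inner: "(\<integral>y. f y \<partial>q x) = (\<integral>y. ?P y \<partial>q x) - (\<integral>y. ?N y \<partial>q x)" if "x \<in> set_pmf p" for x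
    using kernel[OF P that] kernel[OF N that] by (subst f_eq) (rule Bochner_Integration.integral_diff)
  have "integrable (measure_pmf p) (\<lambda>x. \<integral>y. f y \<partial>q x)
     \<longleftrightarrow> integrable (measure_pmf p) (\<lambda>x. (\<integral>y. ?P y \<partial>q x) - (\<integral>y. ?N y \<partial>q x))"
    by (intro integrable_cong_AE) (auto simp: AE_measure_pmf_iff inner)
  then show "integrable (measure_pmf p) (\<lambda>x. \<integral>y. f y \<partial>q x)"
    using pos[OF P] pos[OF N] by auto
  have "(\<integral>x. \<integral>y. f y \<partial>q x \<partial>p) = (\<integral>x. (\<integral>y. ?P y \<partial>q x) - (\<integral>y. ?N y \<partial>q x) \<partial>p)"
    by (intro integral_cong_AE) (auto simp: AE_measure_pmf_iff inner)
  also have "\<dots> = (\<integral>y. ?P y \<partial>bind_pmf p q) - (\<integral>y. ?N y \<partial>bind_pmf p q)"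
    using pos[OF P] pos[OF N] by (subst Bochner_Integration.integral_diff) auto
  also have "\<dots> = (\<integral>y. f y \<partial>bind_pmf p q)"
    by (subst (3) f_eq, subst Bochner_Integration.integral_diff[OF P N]) simp
  finally show "(\<integral>y. f y \<partial>bind_pmf p q) = (\<integral>x. \<integral>y. f y \<partial>q x \<partial>p)" ..
qed

lemma integrable_bounded_pmf:
  fixes f :: "'b \<Rightarrow> 'c::{banach, second_countable_topology}"
  assumes "\<And>y. norm (f y) \<le> B"
  shows "integrable (measure_pmf p) f"
  using assms by (intro measure_pmf.integrable_const_bound[where B = B]) auto

text \<open>For the characteristic functions below, the bounded complex case is enough.\<close>
lemma integral_bind_pmf_complex:
  fixes f :: "'b \<Rightarrow> complex"
  assumes "\<And>y. norm (f y) \<le> B"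
  shows "(\<integral>y. f y \<partial>bind_pmf p q) = (\<integral>x. \<integral>y. f y \<partial>q x \<partial>p)"
proof -
  have int: "integrable (measure_pmf r) f" for r
    using assms by (rule integrable_bounded_pmf)
  have "norm (\<integral>y. f y \<partial>q x) \<le> B" for x
  proof -
    have "(\<integral>y. norm (f y) \<partial>q x) \<le> B"
      using int[of "q x"] assms by (intro measure_pmf.integral_le_const) auto
    then show ?thesis using integral_norm_bound[of "measure_pmf (q x)" f] by linarith
  qed
  then have int2: "integrable (measure_pmf p) (\<lambda>x. \<integral>y. f y \<partial>q x)"
    by (rule integrable_bounded_pmf)
  show ?thesis
  proof (rule complex_eqI)
    show "Re (\<integral>y. f y \<partial>bind_pmf p q) = Re (\<integral>x. \<integral>y. f y \<partial>q x \<partial>p)"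
      using int int2 by (simp add: integral_bind_pmf_iterated flip: integral_Re)
    show "Im (\<integral>y. f y \<partial>bind_pmf p q) = Im (\<integral>x. \<integral>y. f y \<partial>q x \<partial>p)"
      using int int2 by (simp add: integral_bind_pmf_iterated flip: integral_Im)
  qed
qed

text \<open>
  The law of the first \<open>n + 1\<close> states of the chain started at \<open>x\<close>, as a list. The recursion prepends the
  starting point, so that inductions condition on the first step; the finite-dimensional laws of
  the chain become discrete distributions, for which iterated expectations are easy.
\<close>
primrec path_pmf :: "('s \<Rightarrow> 's pmf) \<Rightarrow> nat \<Rightarrow> 's \<Rightarrow> 's list pmf" where
  "path_pmf P 0 x = return_pmf [x]"
| "path_pmf P (Suc n) x = map_pmf ((#) x) (bind_pmf (P x) (path_pmf P n))"

lemma set_path_pmf: "ys \<in> set_pmf (path_pmf P n x) \<Longrightarrow> length ys = Suc n \<and> hd ys = x \<and> ys ! 0 = x \<and> ys \<noteq> []"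
  by (induction n arbitrary: x ys) auto

lemma pmf_path_pmf:
  assumes "length ys = Suc n"
  shows "pmf (path_pmf P n x) ys = (if ys ! 0 = x then (\<Prod>i<n. pmf (P (ys ! i)) (ys ! Suc i)) else 0)"
  using assms
proof (induction n arbitrary: x ys)
  case 0
  then show ?case by (cases ys) (auto simp: indicator_def)
next
  case (Suc n)
  then obtain y zs where ys: "ys = y # zs" "length zs = Suc n" by (cases ys) auto
  show ?case
  proof (cases "y = x")
    case True
    have "pmf (path_pmf P (Suc n) x) ys = pmf (bind_pmf (P x) (path_pmf P n)) zs"
      by (simp add: ys True pmf_map_inj')
    also have "\<dots> = (\<integral>z. pmf (path_pmf P n z) zs \<partial>P x)" by (rule pmf_bind)
    also have "\<dots> = pmf (path_pmf P n (zs ! 0)) zs * pmf (P x) (zs ! 0)"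
      by (subst integral_measure_pmf_real[where A = "{zs ! 0}"]) (auto simp: Suc.IH[OF ys(2)] split: if_splits)
    finally show ?thesis
      using True unfolding ys(1) by (simp add: Suc.IH[OF ys(2)] prod.lessThan_Suc_shift del: path_pmf.simps prod.lessThan_Suc)
  next
    case False
    then have "ys \<notin> set_pmf (path_pmf P (Suc n) x)" using ys by auto
    then show ?thesis using False ys by (simp add: set_pmf_iff del: path_pmf.simps)
  qed
qed

abbreviation path_law :: "'s pmf \<Rightarrow> ('s \<Rightarrow> 's pmf) \<Rightarrow> nat \<Rightarrow> 's list pmf" where
  "path_law \<mu> P n \<equiv> bind_pmf \<mu> (path_pmf P n)"

lemma measurable_coordinate[measurable]:
  "(\<lambda>\<omega>. \<omega> k) \<in> chain \<mu> P \<rightarrow>\<^sub>M count_space UNIV"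
proof -
  have "(\<lambda>\<omega>. \<omega> k) \<in> Pi\<^sub>M UNIV (\<lambda>_. count_space UNIV) \<rightarrow>\<^sub>M count_space UNIV"
    by (rule measurable_component_singleton) simp
  then show ?thesis using measurable_cong_sets[OF sets_chain refl] by blast
qed

lemma map_upt_eq_iff: "map \<omega> [0..<m] = a \<longleftrightarrow> length a = m \<and> (\<forall>i<m. \<omega> i = a ! i)"
proof
  assume "map \<omega> [0..<m] = a"
  then show "length a = m \<and> (\<forall>i<m. \<omega> i = a ! i)" by auto
next
  assume "length a = m \<and> (\<forall>i<m. \<omega> i = a ! i)"
  then show "map \<omega> [0..<m] = a" by (intro nth_equalityI) auto
qed

lemma measurable_chain_map:
  fixes P :: "'s::countable \<Rightarrow> 's pmf"
  shows "(\<lambda>\<omega>. map \<omega> [0..<m]) \<in> chain \<mu> P \<rightarrow>\<^sub>M count_space UNIV"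
proof (subst measurable_count_space_eq2_countable, intro conjI ballI)
  fix a :: "'s list"
  have "(\<lambda>\<omega>. map \<omega> [0..<m]) -` {a} \<inter> space (chain \<mu> P)
    = (if length a = m then {\<omega>\<in>space (chain \<mu> P). \<forall>i\<in>{..<m}. \<omega> i = a ! i} else {})"
    by (auto simp only: vimage_def map_upt_eq_iff singleton_iff split: if_split)
  also have "\<dots> \<in> sets (chain \<mu> P)"
  proof -
    have "{\<omega>\<in>space (chain \<mu> P). \<omega> i = c} \<in> sets (chain \<mu> P)" for i and c :: 's
      using measurable_sets[OF measurable_coordinate, of "{c}" i \<mu> P]
      by (simp add: vimage_def Int_def conj_commute)
    then have "{\<omega>\<in>space (chain \<mu> P). \<forall>i\<in>{..<m}. \<omega> i = a ! i} \<in> sets (chain \<mu> P)"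
      by (intro sets.sets_Collect_finite_All) auto
    then show ?thesis by simp
  qed
  finally show "(\<lambda>\<omega>. map \<omega> [0..<m]) -` {a} \<inter> space (chain \<mu> P) \<in> sets (chain \<mu> P)" .
qed auto

lemma distr_chain_map:
  fixes P :: "'s::countable \<Rightarrow> 's pmf"
  shows "distr (chain \<mu> P) (count_space UNIV) (\<lambda>\<omega>. map \<omega> [0..<Suc n]) = measure_pmf (path_law \<mu> P n)"
proof (rule measure_eqI_countable[where A = UNIV])
  fix a :: "'s list"
  have pre: "(\<lambda>\<omega>. map \<omega> [0..<Suc n]) -` {a} \<inter> space (chain \<mu> P) = (if length a = Suc n then {\<omega>. \<forall>i\<le>n. \<omega> i = a ! i} else {})"
    by (simp add: vimage_def map_upt_eq_iff space_chain less_Suc_eq_le del: upt_Suc)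
  have "emeasure (distr (chain \<mu> P) (count_space UNIV) (\<lambda>\<omega>. map \<omega> [0..<Suc n])) {a}
    = (if length a = Suc n then ennreal (pmf \<mu> (a ! 0) * (\<Prod>i<n. pmf (P (a ! i)) (a ! Suc i))) else 0)"
    unfolding emeasure_distr[OF measurable_chain_map, of "{a}", simplified] pre
    by (simp add: emeasure_chain_cylinder)
  also have "\<dots> = ennreal (pmf (path_law \<mu> P n) a)"
  proof (cases "length a = Suc n")
    case True
    have "pmf (path_law \<mu> P n) a = (\<integral>x. pmf (path_pmf P n x) a \<partial>\<mu>)" by (rule pmf_bind)
    also have "\<dots> = (\<Prod>i<n. pmf (P (a ! i)) (a ! Suc i)) * pmf \<mu> (a ! 0)"
      by (subst integral_measure_pmf_real[where A = "{a ! 0}"]) (auto simp: pmf_path_pmf[OF True] split: if_splits)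
    finally show ?thesis using True by (simp add: mult.commute)
  next
    case False
    then have "a \<notin> set_pmf (path_law \<mu> P n)" using set_path_pmf by fastforce
    then have "pmf (path_law \<mu> P n) a = 0" by (simp only: set_pmf_iff not_not)
    then show ?thesis using False by simp
  qed
  finally show "emeasure (distr (chain \<mu> P) (count_space UNIV) (\<lambda>\<omega>. map \<omega> [0..<Suc n])) {a} = emeasure (measure_pmf (path_law \<mu> P n)) {a}"
    by (simp add: emeasure_pmf_single)
qed auto

lemma integral_chain_path:
  fixes P :: "'s::countable \<Rightarrow> 's pmf" and F :: "'s list \<Rightarrow> 'b::{banach, second_countable_topology}"
  shows "(\<integral>\<omega>. F (map \<omega> [0..<Suc n]) \<partial>chain \<mu> P) = (\<integral>ys. F ys \<partial>path_law \<mu> P n)"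
  unfolding distr_chain_map[symmetric] by (subst integral_distr[OF measurable_chain_map]) auto

lemma integrable_chain_path:
  fixes P :: "'s::countable \<Rightarrow> 's pmf" and F :: "'s list \<Rightarrow> 'b::{banach, second_countable_topology}"
  shows "integrable (chain \<mu> P) (\<lambda>\<omega>. F (map \<omega> [0..<Suc n])) \<longleftrightarrow> integrable (path_law \<mu> P n) F"
  unfolding distr_chain_map[symmetric] by (subst integrable_distr_eq[OF measurable_chain_map]) auto

lemma nn_integral_chain_path:
  fixes P :: "'s::countable \<Rightarrow> 's pmf" and F :: "'s list \<Rightarrow> ennreal"
  shows "(\<integral>\<^sup>+\<omega>. F (map \<omega> [0..<Suc n]) \<partial>chain \<mu> P) = (\<integral>\<^sup>+ys. F ys \<partial>path_law \<mu> P n)"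
  unfolding distr_chain_map[symmetric] by (subst nn_integral_distr[OF measurable_chain_map]) auto

text \<open>Kernel powers append the last step, path laws prepend the first one; this links the two.\<close>
lemma kernel_pow_Suc_left: "kernel_pow P (Suc n) x = bind_pmf (P x) (kernel_pow P n)"
proof (induction n arbitrary: x)
  case (Suc n)
  then show ?case
    by (simp add: kernel_comp_def bind_assoc_pmf)
qed (simp add: kernel_comp_def bind_return_pmf bind_return_pmf')

lemma map_last_path_pmf: "map_pmf (\<lambda>ys. ys ! n) (path_pmf P n x) = kernel_pow P n x"
proof (induction n arbitrary: x)
  case (Suc n)
  have "map_pmf (\<lambda>ys. ys ! Suc n) (path_pmf P (Suc n) x) = bind_pmf (P x) (\<lambda>y. map_pmf (\<lambda>ys. ys ! n) (path_pmf P n y))"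
    by (simp add: map_pmf_comp map_bind_pmf)
  also have "\<dots> = kernel_pow P (Suc n) x" by (simp only: Suc kernel_pow_Suc_left)
  finally show ?case .
qed simp

lemma map_ends_path_pmf:
  "map_pmf (\<lambda>ys. (ys ! 0, ys ! n)) (path_pmf P n x) = map_pmf (Pair x) (kernel_pow P n x)"
proof -
  have "map_pmf (\<lambda>ys. (ys ! 0, ys ! n)) (path_pmf P n x) = map_pmf (\<lambda>ys. (x, ys ! n)) (path_pmf P n x)"
    by (intro map_pmf_cong refl) (simp add: set_path_pmf)
  also have "\<dots> = map_pmf (Pair x) (map_pmf (\<lambda>ys. ys ! n) (path_pmf P n x))"
    by (simp add: map_pmf_comp)
  finally show ?thesis by (simp only: map_last_path_pmf)
qed

text \<open>Stationarity of the path laws under the shift.\<close>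
lemma map_drop_path_law:
  assumes "stationary_distribution P \<pi>"
  shows "map_pmf (drop j) (path_law \<pi> P (j + n)) = path_law \<pi> P n"
proof (induction j)
  case (Suc j)
  have "map_pmf (drop (Suc j)) (path_law \<pi> P (Suc j + n))
      = bind_pmf (bind_pmf \<pi> P) (\<lambda>y. map_pmf (drop j) (path_pmf P (j + n) y))"
    by (simp add: map_bind_pmf map_pmf_comp bind_assoc_pmf)
  also have "\<dots> = map_pmf (drop j) (path_law \<pi> P (j + n))"
    using assms by (simp add: stationary_distribution_def map_bind_pmf)
  finally show ?case using Suc by (simp only:)
qed (simp add: map_pmf_ident[unfolded id_def])

text \<open>The joint law of two states of the stationary chain at distance \<open>k\<close> in time.\<close>
definition pair_law :: "'s pmf \<Rightarrow> ('s \<Rightarrow> 's pmf) \<Rightarrow> nat \<Rightarrow> ('s \<times> 's) pmf" where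
  "pair_law \<pi> P k = bind_pmf \<pi> (\<lambda>x. map_pmf (Pair x) (kernel_pow P k x))"

lemma map_pair_path_law:
  assumes "stationary_distribution P \<pi>"
  shows "map_pmf (\<lambda>ys. (ys ! j, ys ! (j + k))) (path_law \<pi> P (j + k)) = pair_law \<pi> P k"
proof -
  have "map_pmf (\<lambda>ys. (ys ! j, ys ! (j + k))) (path_law \<pi> P (j + k))
     = map_pmf (\<lambda>ys. (drop j ys ! 0, drop j ys ! k)) (path_law \<pi> P (j + k))"
    using set_path_pmf by (intro map_pmf_cong refl) fastforce
  also have "\<dots> = map_pmf (\<lambda>ys. (ys ! 0, ys ! k)) (map_pmf (drop j) (path_law \<pi> P (j + k)))"
    by (simp add: map_pmf_comp)
  also have "\<dots> = map_pmf (\<lambda>ys. (ys ! 0, ys ! k)) (path_law \<pi> P k)"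
    by (simp only: map_drop_path_law[OF assms])
  also have "\<dots> = pair_law \<pi> P k"
    by (simp add: pair_law_def map_bind_pmf map_ends_path_pmf)
  finally show ?thesis .
qed

lemma kernel_pow_stationary:
  assumes "stationary_distribution P \<pi>"
  shows "bind_pmf \<pi> (kernel_pow P k) = \<pi>"
  by (induction k) (use assms in \<open>simp_all add: bind_return_pmf' kernel_comp_def bind_assoc_pmf[symmetric] stationary_distribution_def\<close>)

lemma map_fst_pair_law: "map_pmf fst (pair_law \<pi> P k) = \<pi>"
  by (simp add: pair_law_def map_bind_pmf map_pmf_comp bind_return_pmf')

lemma integral_chain_pair:
  fixes P :: "'s::countable \<Rightarrow> 's pmf" and F :: "'s \<Rightarrow> 's \<Rightarrow> 'b::{banach, second_countable_topology}"
  assumes "stationary_distribution P \<pi>"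
  shows "(\<integral>\<omega>. F (\<omega> j) (\<omega> (j + k)) \<partial>chain \<pi> P) = (\<integral>(x, y). F x y \<partial>pair_law \<pi> P k)"
    and "integrable (chain \<pi> P) (\<lambda>\<omega>. F (\<omega> j) (\<omega> (j + k))) \<longleftrightarrow> integrable (pair_law \<pi> P k) (\<lambda>(x, y). F x y)"
proof -
  have nth: "map \<omega> [0..<Suc (j + k)] ! j = \<omega> j" "map \<omega> [0..<Suc (j + k)] ! (j + k) = \<omega> (j + k)" for \<omega> :: "nat \<Rightarrow> 's"
    by (simp_all del: upt_Suc)
  show "(\<integral>\<omega>. F (\<omega> j) (\<omega> (j + k)) \<partial>chain \<pi> P) = (\<integral>(x, y). F x y \<partial>pair_law \<pi> P k)"
    using integral_chain_path[where F = "\<lambda>ys. F (ys ! j) (ys ! (j + k))" and n = "j + k" and \<mu> = \<pi> and P = P]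
    unfolding map_pair_path_law[OF assms, symmetric, of k j] nth by simp
  show "integrable (chain \<pi> P) (\<lambda>\<omega>. F (\<omega> j) (\<omega> (j + k))) \<longleftrightarrow> integrable (pair_law \<pi> P k) (\<lambda>(x, y). F x y)"
    using integrable_chain_path[where F = "\<lambda>ys. F (ys ! j) (ys ! (j + k))" and n = "j + k" and \<mu> = \<pi> and P = P]
    unfolding map_pair_path_law[OF assms, symmetric, of k j] nth by simp
qed

section \<open>Covariances and return times\<close>

lemma
  fixes P :: "'s::countable \<Rightarrow> 's pmf" and f :: "'s \<Rightarrow> real"
  assumes "stationary_distribution P \<pi>"
  shows integrable_coordinate: "integrable (measure_pmf \<pi>) f \<Longrightarrow> integrable (chain \<pi> P) (\<lambda>\<omega>. f (\<omega> j))"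
    and integral_coordinate: "(\<integral>\<omega>. f (\<omega> j) \<partial>chain \<pi> P) = (\<integral>x. f x \<partial>\<pi>)"
proof -
  have "(\<integral>x. f x \<partial>map_pmf fst (pair_law \<pi> P 0)) = (\<integral>(x, y). f x \<partial>pair_law \<pi> P 0)"
    "integrable (map_pmf fst (pair_law \<pi> P 0)) f \<longleftrightarrow> integrable (pair_law \<pi> P 0) (\<lambda>(x, y). f x)"
    by (simp_all only: integral_map_pmf integrable_map_pmf_eq case_prod_unfold)
  then have fst: "(\<integral>x. f x \<partial>\<pi>) = (\<integral>(x, y). f x \<partial>pair_law \<pi> P 0)"
     "integrable (measure_pmf \<pi>) f \<longleftrightarrow> integrable (pair_law \<pi> P 0) (\<lambda>(x, y). f x)"
    by (simp_all only: map_fst_pair_law)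
  show "integrable (measure_pmf \<pi>) f \<Longrightarrow> integrable (chain \<pi> P) (\<lambda>\<omega>. f (\<omega> j))"
    using integral_chain_pair(2)[OF assms, of "\<lambda>x y. f x" j 0] fst by (simp only:)
  show "(\<integral>\<omega>. f (\<omega> j) \<partial>chain \<pi> P) = (\<integral>x. f x \<partial>\<pi>)"
    using integral_chain_pair(1)[OF assms, of "\<lambda>x y. f x" j 0] fst by (simp only:)
qed

lemma integrable_coordinate_product:
  fixes P :: "'s::countable \<Rightarrow> 's pmf" and h :: "'s \<Rightarrow> real"
  assumes stat: "stationary_distribution P \<pi>" and h: "integrable (measure_pmf \<pi>) (\<lambda>x. (h x)\<^sup>2)"
  shows "integrable (chain \<pi> P) (\<lambda>\<omega>. h (\<omega> j) * h (\<omega> k))"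
proof (rule Bochner_Integration.integrable_bound)
  show "integrable (chain \<pi> P) (\<lambda>\<omega>. (h (\<omega> j))\<^sup>2 + (h (\<omega> k))\<^sup>2)"
    using integrable_coordinate[OF stat h] by auto
  have "(\<lambda>\<omega>. h (\<omega> i)) \<in> borel_measurable (chain \<pi> P)" for i
    using measurable_compose[OF measurable_coordinate, of h borel] by simp
  then show "(\<lambda>\<omega>. h (\<omega> j) * h (\<omega> k)) \<in> borel_measurable (chain \<pi> P)" by simp
  have "\<bar>a * b\<bar> \<le> a\<^sup>2 + b\<^sup>2" for a b :: real
  proof -
    have "2 * (\<bar>a\<bar> * \<bar>b\<bar>) \<le> a\<^sup>2 + b\<^sup>2" using sum_squares_bound[of "\<bar>a\<bar>" "\<bar>b\<bar>"] by simp
    moreover have "0 \<le> \<bar>a\<bar> * \<bar>b\<bar>" by simp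
    ultimately show ?thesis unfolding abs_mult by linarith
  qed
  then show "AE \<omega> in chain \<pi> P. norm (h (\<omega> j) * h (\<omega> k)) \<le> norm ((h (\<omega> j))\<^sup>2 + (h (\<omega> k))\<^sup>2)"
    by simp
qed

lemma autocov_shift:
  fixes P :: "'s::countable \<Rightarrow> 's pmf" and h :: "'s \<Rightarrow> real"
  assumes stat: "stationary_distribution P \<pi>"
  shows "(\<integral>\<omega>. h (\<omega> j) * h (\<omega> (j + k)) \<partial>chain \<pi> P) = autocov \<pi> P h k"
  using integral_chain_pair(1)[OF stat, of "\<lambda>x y. h x * h y" j k]
    integral_chain_pair(1)[OF stat, of "\<lambda>x y. h x * h y" 0 k]
  by (simp only: autocov_def add_0)

text \<open>
  Passing from \<open>n\<close> to \<open>n + 1\<close> summands adds to the second moment the diagonal term and twice the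
  covariances of the new summand with the earlier ones, which is \<open>B\<^sub>n\<close> by stationarity.
\<close>
lemma A_seq_eq_Cesaro_B_seq:
  fixes P :: "'s::countable \<Rightarrow> 's pmf" and h :: "'s \<Rightarrow> real"
  assumes stat: "stationary_distribution P \<pi>" and h: "integrable (measure_pmf \<pi>) (\<lambda>x. (h x)\<^sup>2)"
    and mean: "measure_pmf.expectation \<pi> h = 0"
  shows "A_seq \<pi> P h n = (\<Sum>m<n. B_seq \<pi> P h m) / real n"
proof -
  have h1: "integrable (measure_pmf \<pi>) h"
    using h by (rule measure_pmf.square_integrable_imp_integrable[rotated]) simp
  have prod: "integrable (chain \<pi> P) (\<lambda>\<omega>. h (\<omega> j) * h (\<omega> k))" for j k
    by (rule integrable_coordinate_product[OF stat h])
  have sum0: "(\<integral>\<omega>. partial_sum h n \<omega> \<partial>chain \<pi> P) = 0"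
    using integrable_coordinate[OF stat h1] integral_coordinate[OF stat, of h] mean
    by (simp add: partial_sum_def)
  have sq: "integrable (chain \<pi> P) (\<lambda>\<omega>. (partial_sum h n \<omega>)\<^sup>2) \<and>
      (\<integral>\<omega>. (partial_sum h n \<omega>)\<^sup>2 \<partial>chain \<pi> P) = (\<Sum>m<n. B_seq \<pi> P h m)" for n
  proof (induction n)
    case 0
    then show ?case by (simp add: partial_sum_def)
  next
    case (Suc n)
    have expand: "(partial_sum h (Suc n) \<omega>)\<^sup>2
      = (partial_sum h n \<omega>)\<^sup>2 + (2 * (\<Sum>k<n. h (\<omega> k) * h (\<omega> n)) + h (\<omega> n) * h (\<omega> n))" for \<omega>
      by (simp add: partial_sum_def power2_eq_square algebra_simps sum_distrib_left)
    have "(\<Sum>k<n. \<integral>\<omega>. h (\<omega> k) * h (\<omega> n) \<partial>chain \<pi> P) = (\<Sum>k<n. autocov \<pi> P h (n - k))"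
    proof (intro sum.cong refl)
      fix k assume "k \<in> {..<n}"
      then have "k + (n - k) = n" by simp
      then show "(\<integral>\<omega>. h (\<omega> k) * h (\<omega> n) \<partial>chain \<pi> P) = autocov \<pi> P h (n - k)"
        using autocov_shift[OF stat, of h k "n - k"] by simp
    qed
    also have "\<dots> = (\<Sum>k=1..n. autocov \<pi> P h k)"
      by (rule sum.reindex_bij_witness[of _ "\<lambda>k. n - k" "\<lambda>k. n - k"]) auto
    finally have cross: "(\<Sum>k<n. \<integral>\<omega>. h (\<omega> k) * h (\<omega> n) \<partial>chain \<pi> P) = (\<Sum>k=1..n. autocov \<pi> P h k)" .
    have diag: "(\<integral>\<omega>. h (\<omega> n) * h (\<omega> n) \<partial>chain \<pi> P) = autocov \<pi> P h 0"
      using autocov_shift[OF stat, of h n 0] by simp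
    show ?case
      unfolding expand using Suc prod by (simp add: cross diag B_seq_def)
  qed
  show ?thesis
    using sq[of n] by (simp add: A_seq_def sum0)
qed

text \<open>
  If \<open>u l\<close> is the conditional expectation of \<open>h(X\<^sub>l)\<close> given \<open>X\<^sub>0\<close>, it suffices to check the one-step
  recursion of the \<open>u l\<close>. The integrability claim is recorded because expectations of \<open>h * u k\<close> are later
  evaluated by conditioning.
\<close>
lemma autocov_eq_conditional_expectation:
  fixes P :: "'s::countable \<Rightarrow> 's pmf" and h :: "'s \<Rightarrow> real"
  assumes stat: "stationary_distribution P \<pi>" and h: "integrable (measure_pmf \<pi>) (\<lambda>x. (h x)\<^sup>2)"
    and u0: "u 0 = h"
    and step: "\<And>l x. x \<in> set_pmf \<pi> \<Longrightarrow> (\<integral>y. u l y \<partial>P x) = u (Suc l) x"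
  shows "autocov \<pi> P h k = (\<integral>x. h x * u k x \<partial>\<pi>)"
    and "integrable (measure_pmf \<pi>) (\<lambda>x. h x * u k x)"
proof -
  have u: "integrable (measure_pmf \<pi>) (u l)" for l
  proof (induction l)
    case 0
    show ?case unfolding u0
      using h by (rule measure_pmf.square_integrable_imp_integrable[rotated]) simp
  next
    case (Suc l)
    then have "integrable (measure_pmf (bind_pmf \<pi> P)) (u l)"
      using stat by (simp add: stationary_distribution_def)
    then have "integrable (measure_pmf \<pi>) (\<lambda>x. \<integral>y. u l y \<partial>P x)"
      by (rule integrable_bind_pmf_inner)
    also have "?this \<longleftrightarrow> ?case"
      by (intro integrable_cong_AE) (auto simp: AE_measure_pmf_iff step)
    finally show ?case .
  qed
  have kernel: "(\<integral>y. u l y \<partial>kernel_pow P k x) = u (l + k) x" if x: "x \<in> set_pmf \<pi>" for x l k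
  proof (induction k arbitrary: l)
    case (Suc k)
    have closed: "y \<in> set_pmf \<pi>" if "y \<in> set_pmf (kernel_pow P k x)" for y
    proof -
      have "y \<in> set_pmf (bind_pmf \<pi> (kernel_pow P k))" using that x by auto
      then show ?thesis by (simp only: kernel_pow_stationary[OF stat])
    qed
    have "integrable (bind_pmf \<pi> (kernel_pow P (Suc k))) (u l)"
      unfolding kernel_pow_stationary[OF stat] by (rule u)
    then have "integrable (bind_pmf (kernel_pow P k x) P) (u l)"
      using integrable_bind_pmf_kernel[OF _ x] by (auto simp: kernel_comp_def)
    then have "(\<integral>y. u l y \<partial>kernel_pow P (Suc k) x) = (\<integral>y. (\<integral>z. u l z \<partial>P y) \<partial>kernel_pow P k x)"
      by (simp add: kernel_comp_def integral_bind_pmf_iterated)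
    also have "\<dots> = (\<integral>y. u (Suc l) y \<partial>kernel_pow P k x)"
      by (intro integral_cong_AE) (auto simp: AE_measure_pmf_iff closed step)
    finally show ?case using Suc by simp
  qed simp
  have int: "integrable (pair_law \<pi> P k) (\<lambda>(x, y). h x * h y)"
    using integral_chain_pair(2)[OF stat, of "\<lambda>x y. h x * h y" 0 k] integrable_coordinate_product[OF stat h, of 0 k]
    by simp
  have h_pow: "(\<integral>y. h y \<partial>kernel_pow P k x) = u k x" if "x \<in> set_pmf \<pi>" for x
    using kernel[OF that, where l = 0 and k = k] by (simp add: u0)
  have "autocov \<pi> P h k = (\<integral>(x, y). h x * h y \<partial>pair_law \<pi> P k)"
    using integral_chain_pair(1)[OF stat, of "\<lambda>x y. h x * h y" 0 k] by (simp add: autocov_def)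
  also have "\<dots> = (\<integral>x. (\<integral>y. h x * h y \<partial>kernel_pow P k x) \<partial>\<pi>)"
    using int unfolding pair_law_def by (subst integral_bind_pmf_iterated) auto
  also have "\<dots> = (\<integral>x. h x * u k x \<partial>\<pi>)"
    by (intro integral_cong_AE) (auto simp: AE_measure_pmf_iff h_pow)
  finally show "autocov \<pi> P h k = (\<integral>x. h x * u k x \<partial>\<pi>)" .
  have "integrable (measure_pmf \<pi>) (\<lambda>x. \<integral>z. (case z of (x, y) \<Rightarrow> h x * h y) \<partial>map_pmf (Pair x) (kernel_pow P k x))"
    using int unfolding pair_law_def by (rule integrable_bind_pmf_inner)
  also have "?this \<longleftrightarrow> integrable (measure_pmf \<pi>) (\<lambda>x. h x * u k x)"
    by (intro integrable_cong_AE) (auto simp: AE_measure_pmf_iff h_pow)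
  finally show "integrable (measure_pmf \<pi>) (\<lambda>x. h x * u k x)" .
qed

text \<open>The tail sum of a return time, valid also when the state is never visited again and both sides are infinite.\<close>
lemma return_time_eq_suminf:
  "return_time x \<omega> = (\<Sum>n. indicator {\<omega>. \<forall>k\<in>{1..n}. \<omega> k \<noteq> x} \<omega>)"
proof (cases "\<exists>n\<ge>1. \<omega> n = x")
  case True
  define t where "t = (LEAST n. 1 \<le> n \<and> \<omega> n = x)"
  have t: "1 \<le> t" "\<omega> t = x" using LeastI_ex[of "\<lambda>n. 1 \<le> n \<and> \<omega> n = x"] True unfolding t_def by auto
  have least: "t \<le> n" if "1 \<le> n" "\<omega> n = x" for n
    unfolding t_def using that by (intro Least_le) auto
  have "return_time x \<omega> = of_nat t"
    unfolding return_time_def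
    by (rule antisym[OF INF_lower INF_greatest]) (use t least in auto)
  moreover have "(\<forall>k\<in>{1..n}. \<omega> k \<noteq> x) \<longleftrightarrow> n < t" for n
  proof
    assume "\<forall>k\<in>{1..n}. \<omega> k \<noteq> x"
    then show "n < t" using t by (metis atLeastAtMost_iff not_less)
  next
    assume "n < t"
    then show "\<forall>k\<in>{1..n}. \<omega> k \<noteq> x" using least by fastforce
  qed
  then have "(\<Sum>n. indicator {\<omega>. \<forall>k\<in>{1..n}. \<omega> k \<noteq> x} \<omega>) = (\<Sum>n. indicator {..<t} n :: ennreal)"
    by (intro suminf_cong) (auto simp: indicator_def)
  moreover have "\<dots> = of_nat t"
    by (subst suminf_finite[of "{..<t}"]) auto
  ultimately show ?thesis by simp
next
  case False
  then have "return_time x \<omega> = top"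
    unfolding return_time_def by (auto simp: top_ennreal_def[symmetric] Inf_empty)
  moreover have "(\<Sum>n. indicator {\<omega>. \<forall>k\<in>{1..n}. \<omega> k \<noteq> x} \<omega>) = (\<Sum>n. 1::ennreal)"
    using False by (intro suminf_cong) (auto simp: indicator_def)
  moreover have "(\<Sum>n. 1::ennreal) = top"
    by (simp add: suminf_eq_SUP ennreal_SUP_of_nat_eq_top)
  ultimately show ?thesis by simp
qed

text \<open>
  Half of Kac's lemma. With \<open>v\<close> the probability of avoiding \<open>x\<close> at the times \<open>1..n\<close> and \<open>u\<close> that of avoiding
  \<open>x\<close> at the times \<open>0..n\<close>, the probability of starting at \<open>x\<close> and not returning by time \<open>n\<close>
  is \<open>v n - u n\<close>, and stationarity gives \<open>v (n + 1) = u n\<close>. The sum over \<open>n\<close> telescopes, so the expected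
  return time is at most \<open>1 / \<pi>(x)\<close>.
\<close>
lemma positive_recurrent_if_stationary:
  fixes P :: "'s::countable \<Rightarrow> 's pmf"
  assumes stat: "stationary_distribution P \<pi>" and pos: "\<And>x. pmf \<pi> x > 0"
  shows "positive_recurrent_kernel P"
  unfolding positive_recurrent_kernel_def
proof
  fix x
  define a where "a n = measure (path_pmf P n x) {ys. x \<notin> set (tl ys)}" for n
  define u where "u n = measure (path_law \<pi> P n) {ys. x \<notin> set ys}" for n
  define v where "v n = measure (path_law \<pi> P n) {ys. x \<notin> set (tl ys)}" for n
  have tail: "(\<integral>\<^sup>+\<omega>. indicator {\<omega>. \<forall>k\<in>{1..n}. \<omega> k \<noteq> x} \<omega> \<partial>chain (return_pmf x) P) = ennreal (a n)" for n
  proof -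
    have "(\<forall>k\<in>{1..n}. \<omega> k \<noteq> x) \<longleftrightarrow> x \<notin> set (tl (map \<omega> [0..<Suc n]))" for \<omega>
      by (auto simp: upt_rec[of 0] simp del: upt_Suc)
    then have "(\<integral>\<^sup>+\<omega>. indicator {\<omega>. \<forall>k\<in>{1..n}. \<omega> k \<noteq> x} \<omega> \<partial>chain (return_pmf x) P)
      = (\<integral>\<^sup>+\<omega>. indicator {ys. x \<notin> set (tl ys)} (map \<omega> [0..<Suc n]) \<partial>chain (return_pmf x) P)"
      by (intro nn_integral_cong) (simp add: indicator_def del: upt_Suc)
    also have "\<dots> = (\<integral>\<^sup>+ys. indicator {ys. x \<notin> set (tl ys)} ys \<partial>path_pmf P n x)"
      by (subst nn_integral_chain_path) (simp add: bind_return_pmf)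
    finally show ?thesis by (simp add: a_def measure_pmf.emeasure_eq_measure)
  qed
  have step: "pmf \<pi> x * a n = v n - u n" for n
  proof -
    \<comment> \<open>Intersecting with the support makes the list nonempty, so that head and tail behave as expected.\<close>
    have split: "{ys. x \<notin> set (tl ys)} \<inter> set_pmf (path_law \<pi> P n)
      = ({ys. x \<notin> set ys} \<inter> set_pmf (path_law \<pi> P n)) \<union> ({ys. hd ys = x \<and> x \<notin> set (tl ys)} \<inter> set_pmf (path_law \<pi> P n))"
    proof -
      have "x \<notin> set ys \<longleftrightarrow> hd ys \<noteq> x \<and> x \<notin> set (tl ys)" if "ys \<in> set_pmf (path_law \<pi> P n)" for ys
      proof -
        have "ys \<noteq> []" using that by (auto dest!: set_path_pmf)
        then show ?thesis by (cases ys) auto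
      qed
      then show ?thesis by blast
    qed
    have "measure (path_law \<pi> P n) ({ys. x \<notin> set (tl ys)} \<inter> set_pmf (path_law \<pi> P n))
      = measure (path_law \<pi> P n) ({ys. x \<notin> set ys} \<inter> set_pmf (path_law \<pi> P n))
        + measure (path_law \<pi> P n) ({ys. hd ys = x \<and> x \<notin> set (tl ys)} \<inter> set_pmf (path_law \<pi> P n))"
      unfolding split
    proof (rule measure_pmf.finite_measure_Union)
      show "({ys. x \<notin> set ys} \<inter> set_pmf (path_law \<pi> P n)) \<inter> ({ys. hd ys = x \<and> x \<notin> set (tl ys)} \<inter> set_pmf (path_law \<pi> P n)) = {}"
        by (auto dest!: set_path_pmf)
    qed auto
    then have "v n = u n + measure (path_law \<pi> P n) {ys. hd ys = x \<and> x \<notin> set (tl ys)}"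
      by (simp only: u_def v_def measure_Int_set_pmf)
    also have "measure (path_law \<pi> P n) {ys. hd ys = x \<and> x \<notin> set (tl ys)}
      = (\<integral>y. measure (path_pmf P n y) {ys. hd ys = x \<and> x \<notin> set (tl ys)} \<partial>\<pi>)"
      using integral_bind_pmf_iterated[of \<pi> "path_pmf P n" "indicator {ys. hd ys = x \<and> x \<notin> set (tl ys)}"]
      by (simp add: measure_pmf.emeasure_eq_measure integrable_bounded_pmf)
    also have "\<dots> = (\<integral>y. a n * indicator {x} y \<partial>\<pi>)"
    proof (intro Bochner_Integration.integral_cong refl)
      fix y
      have "measure (path_pmf P n y) {ys. hd ys = x \<and> x \<notin> set (tl ys)}
        = measure (path_pmf P n y) (if y = x then {ys. x \<notin> set (tl ys)} else {})"
        by (rule measure_prob_cong_0)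
          (auto simp: set_pmf_iff[symmetric] pmf_eq_0_set_pmf dest!: set_path_pmf split: if_splits)
      then show "measure (path_pmf P n y) {ys. hd ys = x \<and> x \<notin> set (tl ys)} = a n * indicator {x} y"
        by (simp add: a_def)
    qed
    also have "\<dots> = a n * pmf \<pi> x" by (simp add: measure_pmf_single)
    finally show ?thesis by (simp add: mult.commute)
  qed
  have v0: "v 0 \<le> 1" by (simp add: v_def)
  have vS: "v (Suc n) = u n" for n
  proof -
    have "u n = measure (map_pmf (drop 1) (path_law \<pi> P (1 + n))) {ys. x \<notin> set ys}"
      unfolding u_def map_drop_path_law[OF stat] ..
    also have "\<dots> = v (Suc n)" by (simp add: v_def vimage_def drop_Suc del: path_pmf.simps)
    finally show ?thesis by simp
  qed
  have partial: "(\<Sum>n<N. pmf \<pi> x * a n) \<le> 1" for N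
  proof -
    have "(\<Sum>n<N. pmf \<pi> x * a n) = (if N = 0 then 0 else v 0 - u (N - 1))"
      by (induction N) (auto simp: step vS gr0_conv_Suc)
    also have "\<dots> \<le> 1" using v0 by (auto simp: u_def intro: order_trans[of _ "v 0"])
    finally show ?thesis .
  qed
  have a_nonneg: "a n \<ge> 0" for n by (simp add: a_def)
  have "(\<integral>\<^sup>+\<omega>. return_time x \<omega> \<partial>chain (return_pmf x) P) = (\<Sum>n. ennreal (a n))"
    unfolding return_time_eq_suminf
  proof (subst nn_integral_suminf)
    fix n
    have "{\<omega>\<in>space (chain (return_pmf x) P). \<forall>k\<in>{1..n}. \<omega> k \<noteq> x} \<in> sets (chain (return_pmf x) P)"
    proof (intro sets.sets_Collect_finite_All)
      fix k
      have "(\<lambda>\<omega>. \<omega> k) -` (- {x}) \<inter> space (chain (return_pmf x) P) \<in> sets (chain (return_pmf x) P)"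
        by (rule measurable_sets[OF measurable_coordinate]) simp
      moreover have "(\<lambda>\<omega>. \<omega> k) -` (- {x}) \<inter> space (chain (return_pmf x) P) = {\<omega>\<in>space (chain (return_pmf x) P). \<omega> k \<noteq> x}"
        by auto
      ultimately show "{\<omega>\<in>space (chain (return_pmf x) P). \<omega> k \<noteq> x} \<in> sets (chain (return_pmf x) P)" by simp
    qed auto
    then show "indicator {\<omega>. \<forall>k\<in>{1..n}. \<omega> k \<noteq> x} \<in> borel_measurable (chain (return_pmf x) P)"
      by (simp add: space_chain)
  qed (simp only: tail)
  also have "\<dots> < \<infinity>"
  proof -
    have "(\<Sum>n. ennreal (a n)) \<le> ennreal (1 / pmf \<pi> x)"
      unfolding suminf_eq_SUP
    proof (rule SUP_least)
      fix N
      have "(\<Sum>n<N. a n) \<le> 1 / pmf \<pi> x"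
      proof -
        have "pmf \<pi> x * (\<Sum>n<N. a n) \<le> 1" using partial[of N] by (simp add: sum_distrib_left)
        then show ?thesis using pos[of x] by (simp add: pos_le_divide_eq mult.commute)
      qed
      then show "(\<Sum>n<N. ennreal (a n)) \<le> ennreal (1 / pmf \<pi> x)"
        using a_nonneg by (simp add: ennreal_leI)
    qed
    then show ?thesis by (rule le_less_trans) simp
  qed
  finally show "(\<integral>\<^sup>+\<omega>. return_time x \<omega> \<partial>chain (return_pmf x) P) < \<infinity>" .
qed

section \<open>A central limit theorem for fair signs plus a coboundary\<close>

definition fair_sign :: "real pmf" where "fair_sign = pmf_of_set {- 1, 1}"

lemma integral_fair_sign: "(\<integral>r. f r \<partial>fair_sign) = (1/2) *\<^sub>R (f (- 1) + f 1 :: 'b::{banach, second_countable_topology})"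
  unfolding fair_sign_def
  by (subst integral_measure_pmf[where A = "{- 1, 1}"]) (auto simp: scaleR_add_right)

text \<open>
  If the sign of the next state is fair whatever the present state, the signs along a path are
  independent. The starting point is averaged over one step because its own sign would otherwise be
  deterministic.
\<close>
lemma path_char_fair_signs:
  assumes coin: "\<And>x. map_pmf e (P x) = fair_sign"
  shows "(\<integral>ys. iexp (s * (\<Sum>k<n. e (ys ! k))) \<partial>bind_pmf (P x) (path_pmf P n)) = of_real (cos s) ^ n"
proof (induction n arbitrary: x)
  case (Suc n)
  have bound: "norm (iexp (f y)) \<le> 1" for f :: "'b \<Rightarrow> real" and y by simp
  have "(\<integral>ys. iexp (s * (\<Sum>k<Suc n. e (ys ! k))) \<partial>bind_pmf (P x) (path_pmf P (Suc n)))
    = (\<integral>y. (\<integral>ys. iexp (s * (\<Sum>k<Suc n. e (ys ! k))) \<partial>path_pmf P (Suc n) y) \<partial>P x)"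
    by (rule integral_bind_pmf_complex[where B = 1]) simp
  also have "\<dots> = (\<integral>y. iexp (s * e y) * of_real (cos s) ^ n \<partial>P x)"
  proof (intro Bochner_Integration.integral_cong refl)
    fix y
    have "(\<integral>ys. iexp (s * (\<Sum>k<Suc n. e (ys ! k))) \<partial>path_pmf P (Suc n) y)
      = (\<integral>zs. iexp (s * (\<Sum>k<Suc n. e ((y # zs) ! k))) \<partial>bind_pmf (P y) (path_pmf P n))"
      by simp
    also have "\<dots> = (\<integral>zs. iexp (s * e y) * iexp (s * (\<Sum>k<n. e (zs ! k))) \<partial>bind_pmf (P y) (path_pmf P n))"
      by (intro Bochner_Integration.integral_cong refl)
        (simp add: sum.lessThan_Suc_shift distrib_left exp_add del: sum.lessThan_Suc)
    also have "\<dots> = iexp (s * e y) * of_real (cos s) ^ n"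
      by (simp only: integral_mult_right_zero Suc)
    finally show "(\<integral>ys. iexp (s * (\<Sum>k<Suc n. e (ys ! k))) \<partial>path_pmf P (Suc n) y) = iexp (s * e y) * of_real (cos s) ^ n" .
  qed
  also have "\<dots> = (\<integral>y. iexp (s * e y) \<partial>P x) * of_real (cos s) ^ n"
    by (simp only: integral_mult_left_zero)
  also have "(\<integral>y. iexp (s * e y) \<partial>P x) = (\<integral>r. iexp (s * r) \<partial>map_pmf e (P x))"
    by simp
  also have "\<dots> = of_real (cos s)"
    unfolding coin integral_fair_sign by (simp add: complex_eq_iff Re_exp Im_exp)
  finally show ?case by simp
qed simp

lemma path_sum_coboundary:
  assumes "ys \<in> set_pmf (path_pmf P n x)" and g: "\<And>x y. y \<in> set_pmf (P x) \<Longrightarrow> g x = G y - G x"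
  shows "(\<Sum>k<n. g (ys ! k)) = G (ys ! n) - (G (ys ! 0) :: real)"
  using assms(1)
proof (induction n arbitrary: x ys)
  case (Suc n)
  then obtain y zs where y: "y \<in> set_pmf (P x)" and zs: "zs \<in> set_pmf (path_pmf P n y)" and ys: "ys = x # zs"
    by auto
  have "zs ! 0 = y" using set_path_pmf[OF zs] by simp
  then show ?case
    using Suc.IH[OF zs] g[OF y] by (simp add: ys sum.lessThan_Suc_shift del: sum.lessThan_Suc)
qed simp

lemma norm_iexp_diff_le: "norm (iexp a - iexp b) \<le> min 2 \<bar>a - b\<bar>"
proof -
  have "iexp a - iexp b = iexp b * (iexp (a - b) - 1)"
    by (simp add: right_diff_distrib flip: exp_add)
  then have "norm (iexp a - iexp b) = norm (iexp (a - b) - 1)"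
    by (simp add: norm_mult)
  also have "\<dots> \<le> \<bar>a - b\<bar>" using iexp_approx1[of "a - b" 0] by simp
  finally have "norm (iexp a - iexp b) \<le> \<bar>a - b\<bar>" .
  moreover have "norm (iexp a - iexp b) \<le> 2"
    using norm_triangle_ineq4[of "iexp a" "iexp b"] by simp
  ultimately show ?thesis by simp
qed

text \<open>The limit is computed for positive \<open>t\<close>, where the asymptotic expansion knows the sign of \<open>t\<close>, and extended by symmetry.\<close>
lemma cos_power_tendsto: "(\<lambda>n. cos (t / sqrt (real n)) ^ n) \<longlonglongrightarrow> exp (- (t\<^sup>2) / 2)"
proof -
  have pos: "(\<lambda>n. cos (u / sqrt (real n)) ^ n) \<longlonglongrightarrow> exp (- (u\<^sup>2) / 2)" if "u > 0" for u :: real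
    using that by (real_asymp simp: power2_eq_square)
  consider "t > 0" | "t = 0" | "- t > 0" by linarith
  then show ?thesis
  proof cases
    case 1
    then show ?thesis by (rule pos)
  next
    case 2
    then show ?thesis by simp
  next
    case 3
    then show ?thesis using pos[of "- t"] by simp
  qed
qed

text \<open>
  The sums of \<open>h\<close> and of \<open>e\<close> differ by
  \<open>G(X\<^sub>n) - G(X\<^sub>0)\<close>, and since \<open>X\<^sub>0\<close> and \<open>X\<^sub>n\<close> both have law \<open>\<pi>\<close>, the two characteristic functions differ by at most twice
  the mean of \<open>min 2 (\<bar>t\<bar> * \<bar>G\<bar> / sqrt n)\<close> under \<open>\<pi>\<close>, which tends to 0 by dominated convergence.
\<close>
lemma sqrt_n_CLT_sign_plus_coboundary:
  fixes P :: "'s::countable \<Rightarrow> 's pmf" and e g G h :: "'s \<Rightarrow> real"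
  assumes stat: "stationary_distribution P \<pi>"
    and coin: "\<And>x. map_pmf e (P x) = fair_sign"
    and g: "\<And>x y. y \<in> set_pmf (P x) \<Longrightarrow> g x = G y - G x"
    and h: "\<And>x. h x = e x + g x"
  shows "sqrt_n_CLT \<pi> P h"
proof -
  define M where "M n = distr (chain \<pi> P) borel (\<lambda>\<omega>. partial_sum h n \<omega> / sqrt (real n))" for n
  interpret C: prob_space "chain \<pi> P" by (rule prob_space_chain)
  have meas: "(\<lambda>\<omega>. partial_sum h n \<omega> / sqrt (real n)) \<in> borel_measurable (chain \<pi> P)" for n
  proof -
    have "(\<lambda>\<omega>. h (\<omega> i)) \<in> borel_measurable (chain \<pi> P)" for i
      using measurable_compose[OF measurable_coordinate, of h borel] by simp
    then show ?thesis unfolding partial_sum_def by (intro borel_measurable_divide borel_measurable_sum) auto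
  qed
  have real_distr: "real_distribution (M n)" for n
    unfolding M_def using meas by (rule C.real_distribution_distr)
  have marg: "map_pmf (\<lambda>ys. ys ! k) (path_law \<pi> P n) = \<pi>" if "k = 0 \<or> k = n" for k n
    using that
  proof
    assume "k = n"
    then show ?thesis by (simp add: map_bind_pmf map_last_path_pmf kernel_pow_stationary[OF stat])
  next
    assume "k = 0"
    have "map_pmf (\<lambda>ys. ys ! 0) (path_pmf P n x) = return_pmf x" for x
    proof -
      have "map_pmf (\<lambda>ys. ys ! 0) (path_pmf P n x) = map_pmf (\<lambda>ys. x) (path_pmf P n x)"
        by (intro map_pmf_cong refl) (simp add: set_path_pmf)
      then show ?thesis by simp
    qed
    then show ?thesis using \<open>k = 0\<close> by (simp add: map_bind_pmf bind_return_pmf')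
  qed
  have diff: "norm (char (M n) t - of_real (cos (t / sqrt (real n)) ^ n))
     \<le> 2 * (\<integral>x. min 2 (\<bar>t / sqrt (real n)\<bar> * \<bar>G x\<bar>) \<partial>\<pi>)" for n t
  proof -
    define s where "s = t / sqrt (real n)"
    let ?L = "path_law \<pi> P n" and ?m = "\<lambda>x. min 2 (\<bar>s\<bar> * \<bar>G x\<bar>)"
    let ?h = "\<lambda>ys. iexp (s * (\<Sum>k<n. h (ys ! k)))" and ?e = "\<lambda>ys. iexp (s * (\<Sum>k<n. e (ys ! k)))"
    have "char (M n) t = (\<integral>\<omega>. iexp (t * (partial_sum h n \<omega> / sqrt (real n))) \<partial>chain \<pi> P)"
      unfolding char_def M_def by (subst integral_distr[OF meas]) auto
    also have "\<dots> = (\<integral>\<omega>. ?h (map \<omega> [0..<Suc n]) \<partial>chain \<pi> P)"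
      by (simp add: partial_sum_def s_def nth_append)
    also have "\<dots> = (\<integral>ys. ?h ys \<partial>?L)" by (rule integral_chain_path)
    finally have char_eq: "char (M n) t = (\<integral>ys. ?h ys \<partial>?L)" .
    have "(\<integral>ys. ?e ys \<partial>?L) = (\<integral>ys. ?e ys \<partial>bind_pmf (bind_pmf \<pi> P) (path_pmf P n))"
      using stat by (simp add: stationary_distribution_def)
    also have "\<dots> = (\<integral>x. (\<integral>ys. ?e ys \<partial>bind_pmf (P x) (path_pmf P n)) \<partial>\<pi>)"
      unfolding bind_assoc_pmf by (rule integral_bind_pmf_complex[where B = 1]) simp
    also have "\<dots> = of_real (cos s ^ n)"
      by (simp only: path_char_fair_signs[where e = e and P = P, OF coin] of_real_power) simp
    finally have e_eq: "(\<integral>ys. ?e ys \<partial>?L) = of_real (cos s ^ n)" .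
    have int: "integrable ?L ?h" "integrable ?L ?e"
      by (rule integrable_bounded_pmf[where B = 1], simp)+
    have intm: "integrable ?L (\<lambda>ys. ?m (ys ! k))" for k
      by (rule integrable_bounded_pmf[where B = 2]) simp
    have "norm (char (M n) t - of_real (cos s ^ n)) = norm (\<integral>ys. ?h ys - ?e ys \<partial>?L)"
      unfolding char_eq e_eq[symmetric] using int by (subst Bochner_Integration.integral_diff) auto
    also have "\<dots> \<le> (\<integral>ys. norm (?h ys - ?e ys) \<partial>?L)"
      by (rule integral_norm_bound)
    also have "\<dots> \<le> (\<integral>ys. ?m (ys ! n) + ?m (ys ! 0) \<partial>?L)"
    proof (rule integral_mono_AE)
      show "integrable ?L (\<lambda>ys. norm (?h ys - ?e ys))" using int by auto
      show "integrable ?L (\<lambda>ys. ?m (ys ! n) + ?m (ys ! 0))" using intm by auto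
      show "AE ys in ?L. norm (?h ys - ?e ys) \<le> ?m (ys ! n) + ?m (ys ! 0)"
      proof (simp only: AE_measure_pmf_iff, intro ballI)
        fix ys assume "ys \<in> set_pmf ?L"
        then obtain x where "ys \<in> set_pmf (path_pmf P n x)" by auto
        from path_sum_coboundary[OF this, of g G] g
        have "(\<Sum>k<n. h (ys ! k)) - (\<Sum>k<n. e (ys ! k)) = G (ys ! n) - G (ys ! 0)"
          by (simp add: h sum.distrib)
        then have "norm (?h ys - ?e ys) \<le> min 2 \<bar>s * (G (ys ! n) - G (ys ! 0))\<bar>"
          using norm_iexp_diff_le[of "s * (\<Sum>k<n. h (ys ! k))" "s * (\<Sum>k<n. e (ys ! k))"]
          by (simp only: right_diff_distrib[symmetric])
        also have "\<dots> \<le> min 2 (\<bar>s\<bar> * \<bar>G (ys ! n)\<bar> + \<bar>s\<bar> * \<bar>G (ys ! 0)\<bar>)"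
          unfolding abs_mult distrib_left[symmetric]
          by (intro min.mono order_refl mult_left_mono) auto
        also have "\<dots> \<le> ?m (ys ! n) + ?m (ys ! 0)"
        proof -
          have "min 2 (a + b) \<le> min 2 a + min 2 b" if "a \<ge> 0" "b \<ge> 0" for a b :: real
            using that by (simp add: min_def)
          then show ?thesis by simp
        qed
        finally show "norm (?h ys - ?e ys) \<le> ?m (ys ! n) + ?m (ys ! 0)" .
      qed
    qed
    also have "\<dots> = (\<integral>x. ?m x \<partial>map_pmf (\<lambda>ys. ys ! n) ?L) + (\<integral>x. ?m x \<partial>map_pmf (\<lambda>ys. ys ! 0) ?L)"
      using intm by (simp only: integral_map_pmf Bochner_Integration.integral_add)
    also have "\<dots> = 2 * (\<integral>x. ?m x \<partial>\<pi>)" by (simp only: marg[OF disjI1[OF refl]] marg[OF disjI2[OF refl]])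
    finally show ?thesis unfolding s_def .
  qed
  have "weak_conv_m M std_normal_distribution"
  proof (rule levy_continuity)
    fix t :: real
    have "(\<lambda>n. (\<integral>x. min 2 (\<bar>t / sqrt (real n)\<bar> * \<bar>G x\<bar>) \<partial>\<pi>)) \<longlonglongrightarrow> (\<integral>x. 0 \<partial>\<pi>)"
    proof (rule integral_dominated_convergence[where w = "\<lambda>_. 2"])
      show "AE x in \<pi>. (\<lambda>n. min 2 (\<bar>t / sqrt (real n)\<bar> * \<bar>G x\<bar>)) \<longlonglongrightarrow> 0"
      proof (intro AE_I2)
        fix x
        have "(\<lambda>n. t / sqrt (real n)) \<longlonglongrightarrow> 0"
          by (intro tendsto_divide_0[OF tendsto_const] filterlim_at_top_imp_at_infinity
              filterlim_compose[OF sqrt_at_top filterlim_real_sequentially])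
        then have "(\<lambda>n. min 2 (\<bar>t / sqrt (real n)\<bar> * \<bar>G x\<bar>)) \<longlonglongrightarrow> min 2 (\<bar>0\<bar> * \<bar>G x\<bar>)"
          by (intro tendsto_intros)
        then show "(\<lambda>n. min 2 (\<bar>t / sqrt (real n)\<bar> * \<bar>G x\<bar>)) \<longlonglongrightarrow> 0" by simp
      qed
    qed auto
    then have "(\<lambda>n. 2 * (\<integral>x. min 2 (\<bar>t / sqrt (real n)\<bar> * \<bar>G x\<bar>) \<partial>\<pi>)) \<longlonglongrightarrow> 0"
      using tendsto_mult_right_zero by fastforce
    then have "(\<lambda>n. char (M n) t - of_real (cos (t / sqrt (real n)) ^ n)) \<longlonglongrightarrow> 0"
      by (rule Lim_null_comparison[rotated]) (use diff in \<open>auto intro!: always_eventually\<close>)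
    moreover have "(\<lambda>n. complex_of_real (cos (t / sqrt (real n)) ^ n)) \<longlonglongrightarrow> of_real (exp (- (t\<^sup>2) / 2))"
      by (intro tendsto_of_real cos_power_tendsto)
    ultimately have "(\<lambda>n. char (M n) t - of_real (cos (t / sqrt (real n)) ^ n) + of_real (cos (t / sqrt (real n)) ^ n))
       \<longlonglongrightarrow> 0 + complex_of_real (exp (- (t\<^sup>2) / 2))"
      by (rule tendsto_add)
    then show "(\<lambda>n. char (M n) t) \<longlonglongrightarrow> char std_normal_distribution t"
      by (simp add: char_std_normal_distribution)
  qed (use real_distr real_dist_normal_dist in auto)
  moreover have "centered_normal 1 = std_normal_distribution"
    by (simp add: centered_normal_def)
  ultimately show ?thesis
    unfolding sqrt_n_CLT_def M_def[abs_def] by (intro exI[of _ 1]) auto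
qed

section \<open>Averages of sparse peaks\<close>

text \<open>Finitely many terms do not influence the Cesaro limit.\<close>
lemma Cesaro_ge_eventual_bound:
  fixes b :: "nat \<Rightarrow> real"
  assumes lim: "(\<lambda>n. (\<Sum>m<n. b m) / real n) \<longlonglongrightarrow> a" and ev: "eventually (\<lambda>m. b m \<ge> c) sequentially"
  shows "a \<ge> c"
proof -
  obtain N where N: "\<And>m. m \<ge> N \<Longrightarrow> b m \<ge> c" using ev by (auto simp: eventually_sequentially)
  let ?K = "\<Sum>m<N. b m - c"
  have le: "c + ?K / real n \<le> (\<Sum>m<n. b m) / real n" if n: "n > N" for n
  proof -
    have "(\<Sum>m\<in>{N..<n}. b m - c) \<ge> 0"
      using N by (intro sum_nonneg) auto
    then have "?K \<le> (\<Sum>m<N. b m - c) + (\<Sum>m\<in>{N..<n}. b m - c)" by simp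
    also have "\<dots> = (\<Sum>m<n. b m - c)"
      using n by (simp add: lessThan_atLeast0 sum.atLeastLessThan_concat)
    also have "\<dots> = (\<Sum>m<n. b m) - real n * c" by (simp add: sum_subtractf)
    finally have "c * real n + ?K \<le> (\<Sum>m<n. b m)" by (simp add: mult.commute)
    then have "(c * real n + ?K) / real n \<le> (\<Sum>m<n. b m) / real n"
      by (rule divide_right_mono) simp
    then show ?thesis using n by (simp add: add_divide_distrib)
  qed
  have "(\<lambda>n. c + ?K / real n) \<longlonglongrightarrow> c + 0"
    by (intro tendsto_add tendsto_const lim_const_over_n)
  then have "c + 0 \<le> a"
  proof (rule LIMSEQ_le[OF _ lim])
    show "\<exists>M. \<forall>n\<ge>M. c + ?K / real n \<le> (\<Sum>m<n. b m) / real n"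
      using le by (intro exI[of _ "Suc N"]) auto
  qed
  then show ?thesis by simp
qed

text \<open>
  An average of functions \<open>D i\<close> each of which vanishes eventually, with bounds uniform in \<open>i\<close> from below and for the
  Cesaro means, but with peaks that outgrow the weights \<open>\<theta>\<close>.
\<close>
locale sparse_peaks =
  fixes \<theta> :: "nat pmf" and D :: "nat \<Rightarrow> nat \<Rightarrow> real" and L :: "nat \<Rightarrow> nat" and C :: real
  assumes lower: "\<And>i m. D i m \<ge> - C"
    and Cesaro: "\<And>i T. (\<Sum>m<T. D i m) \<le> C * real T"
    and vanish: "\<And>i m. m \<ge> L i \<Longrightarrow> D i m = 0"
    and int: "\<And>m. integrable (measure_pmf \<theta>) (\<lambda>i. D i m)"
    and peak: "\<And>i. i > 0 \<Longrightarrow> \<exists>m. pmf \<theta> i * D i m \<ge> real i"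
begin

definition B :: "nat \<Rightarrow> real" where "B m = 1 + 2 * (\<integral>i. D i m \<partial>\<theta>)"

lemma C_nonneg: "C \<ge> 0"
  using lower[of 0 0] Cesaro[of 0 1] by simp

lemma Cesaro_B: "(\<lambda>n. (\<Sum>m<n. B m) / real n) \<longlonglongrightarrow> 1"
proof -
  have "(\<lambda>n. \<integral>i. (\<Sum>m<n. D i m) / real n \<partial>\<theta>) \<longlonglongrightarrow> (\<integral>i. 0 \<partial>\<theta>)"
  proof (rule integral_dominated_convergence[where w = "\<lambda>_. C"])
    show "AE i in \<theta>. (\<lambda>n. (\<Sum>m<n. D i m) / real n) \<longlonglongrightarrow> 0"
    proof (intro AE_I2)
      fix i
      have eq: "(\<Sum>m<L i. D i m) / real n = (\<Sum>m<n. D i m) / real n" if "n \<ge> L i" for n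
        using that vanish by (intro arg_cong2[of _ _ _ _ "(/)"] sum.mono_neutral_left) auto
      have "eventually (\<lambda>n. (\<Sum>m<L i. D i m) / real n = (\<Sum>m<n. D i m) / real n) sequentially"
      proof (rule eventually_sequentiallyI[of "L i"])
        fix n assume "L i \<le> n"
        then show "(\<Sum>m<L i. D i m) / real n = (\<Sum>m<n. D i m) / real n" by (rule eq)
      qed
      then show "(\<lambda>n. (\<Sum>m<n. D i m) / real n) \<longlonglongrightarrow> 0"
        by (rule Lim_transform_eventually[OF lim_const_over_n])
    qed
    fix n
    show "AE i in \<theta>. norm ((\<Sum>m<n. D i m) / real n) \<le> C"
    proof (intro AE_I2)
      fix i
      have "(\<Sum>m<n. D i m) \<ge> - C * real n"
        using sum_mono[of "{..<n}" "\<lambda>_. - C" "D i"] lower by (simp add: mult.commute)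
      then show "norm ((\<Sum>m<n. D i m) / real n) \<le> C"
        using Cesaro[where i = i and T = n] C_nonneg by (cases "n = 0") (auto simp: abs_le_iff field_simps)
    qed
  qed auto
  then have "(\<lambda>n. 1 + 2 * (\<integral>i. (\<Sum>m<n. D i m) / real n \<partial>\<theta>)) \<longlonglongrightarrow> 1 + 2 * 0"
    by (intro tendsto_intros) simp
  moreover have "eventually (\<lambda>n. 1 + 2 * (\<integral>i. (\<Sum>m<n. D i m) / real n \<partial>\<theta>) = (\<Sum>m<n. B m) / real n) sequentially"
    using eventually_gt_at_top[of 0]
  proof eventually_elim
    case (elim n)
    then show ?case
      using int by (simp add: B_def sum.distrib sum_distrib_left[symmetric] field_simps)
  qed
  ultimately show ?thesis by (simp add: Lim_transform_eventually)
qed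

text \<open>
  The limit of the Cesaro means bounds the limes inferior from above. For the bound from
  below only the negative parts of the \<open>D i\<close> matter, and these are dominated.
\<close>
lemma liminf_B: "liminf (\<lambda>n. ereal (B n)) = 1"
proof (rule antisym)
  show "liminf (\<lambda>n. ereal (B n)) \<le> 1"
  proof (rule ccontr)
    assume "\<not> liminf (\<lambda>n. ereal (B n)) \<le> 1"
    then have "ereal 1 < liminf (\<lambda>n. ereal (B n))" by (simp add: one_ereal_def)
    then obtain c where c: "ereal 1 < ereal c" "ereal c < liminf (\<lambda>n. ereal (B n))"
      using ereal_dense2 by blast
    then have "eventually (\<lambda>n. ereal c < ereal (B n)) sequentially"
      by (intro less_LiminfD)
    then have "eventually (\<lambda>n. B n \<ge> c) sequentially"
      by (rule eventually_mono) simp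
    then have "1 \<ge> c" by (rule Cesaro_ge_eventual_bound[OF Cesaro_B])
    then show False using c by simp
  qed
  have "(\<lambda>n. \<integral>i. min 0 (D i n) \<partial>\<theta>) \<longlonglongrightarrow> (\<integral>i. 0 \<partial>\<theta>)"
  proof (rule integral_dominated_convergence[where w = "\<lambda>_. C"])
    show "AE i in \<theta>. (\<lambda>n. min 0 (D i n)) \<longlonglongrightarrow> 0"
    proof (intro AE_I2)
      fix i
      have "eventually (\<lambda>n. 0 = min 0 (D i n)) sequentially"
        using vanish[of i] by (auto simp: eventually_sequentially intro!: exI[of _ "L i"])
      then show "(\<lambda>n. min 0 (D i n)) \<longlonglongrightarrow> 0"
        by (rule Lim_transform_eventually[OF tendsto_const])
    qed
    show "AE i in \<theta>. norm (min 0 (D i n)) \<le> C" for n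
      using lower[of _ n] C_nonneg by (auto simp: min_def abs_if minus_le_iff)
  qed auto
  then have "(\<lambda>n. 1 + 2 * (\<integral>i. min 0 (D i n) \<partial>\<theta>)) \<longlonglongrightarrow> 1 + 2 * 0"
    by (intro tendsto_intros) simp
  then have "(\<lambda>n. ereal (1 + 2 * (\<integral>i. min 0 (D i n) \<partial>\<theta>))) \<longlonglongrightarrow> 1"
    by (simp add: one_ereal_def)
  then have "1 = liminf (\<lambda>n. ereal (1 + 2 * (\<integral>i. min 0 (D i n) \<partial>\<theta>)))"
    by (simp add: lim_imp_Liminf)
  also have "\<dots> \<le> liminf (\<lambda>n. ereal (B n))"
  proof (intro Liminf_mono always_eventually allI)
    fix n
    have "(\<integral>i. min 0 (D i n) \<partial>\<theta>) \<le> (\<integral>i. D i n \<partial>\<theta>)"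
      using int by (intro integral_mono) auto
    then show "ereal (1 + 2 * (\<integral>i. min 0 (D i n) \<partial>\<theta>)) \<le> ereal (B n)"
      by (simp add: B_def)
  qed
  finally show "1 \<le> liminf (\<lambda>n. ereal (B n))" .
qed

text \<open>At the peak of \<open>D i\<close> the other terms can cost at most \<open>C\<close>, so \<open>B\<close> is unbounded.\<close>
lemma limsup_B: "limsup (\<lambda>n. ereal (B n)) = \<infinity>"
proof (rule ccontr)
  assume "limsup (\<lambda>n. ereal (B n)) \<noteq> \<infinity>"
  then obtain c where "limsup (\<lambda>n. ereal (B n)) < ereal c"
    using less_PInf_Ex_of_nat[of "limsup (\<lambda>n. ereal (B n))"] by auto
  then have "eventually (\<lambda>n. ereal (B n) < ereal c) sequentially"
    by (rule Limsup_lessD)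
  then obtain N where N: "\<And>n. n \<ge> N \<Longrightarrow> B n < c" by (auto simp: eventually_sequentially)
  define c' where "c' = Max (insert c (B ` {..N}))"
  have bdd: "B n \<le> c'" for n
  proof (cases "n \<le> N")
    case True
    then show ?thesis unfolding c'_def by (intro Max_ge) auto
  next
    case False
    then have "B n \<le> c" using N[of n] by simp
    also have "c \<le> c'" unfolding c'_def by (intro Max_ge) auto
    finally show ?thesis .
  qed
  \<comment> \<open>The \<open>i\<close>-th peak exceeds every bound on \<open>B\<close>, even after the loss of \<open>C\<close>.\<close>
  obtain i :: nat where i: "real i > max 0 (c' + 2 * C)" using reals_Archimedean2 by blast
  then have "i > 0" by (cases i) auto
  then obtain m where m: "pmf \<theta> i * D i m \<ge> real i" using peak by blast
  have "pmf \<theta> i * (D i m + C) = (\<integral>j. (D i m + C) * indicator {i} j \<partial>\<theta>)"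
    by (simp add: measure_pmf_single)
  also have "\<dots> \<le> (\<integral>j. D j m + C \<partial>\<theta>)"
  proof (rule integral_mono)
    show "(D i m + C) * indicator {i} j \<le> D j m + C" for j
      using lower[of j m] by (auto simp: indicator_def)
    show "integrable (measure_pmf \<theta>) (\<lambda>j. (D i m + C) * indicator {i} j)"
      by (intro integrable_mult_right measure_pmf.integrable_const_bound[where B = 1]) auto
  qed (use int in auto)
  also have "\<dots> = (\<integral>j. D j m \<partial>\<theta>) + C" using int by simp
  finally have "real i \<le> (\<integral>j. D j m \<partial>\<theta>) + C"
    using m mult_nonneg_nonneg[OF pmf_nonneg[of \<theta> i] C_nonneg] by (simp add: distrib_left)
  then show False using bdd[of m] i C_nonneg unfolding B_def by (simp add: max_def split: if_splits)
qed

end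

section \<open>Reversibility, irreducibility, aperiodicity\<close>

lemma reversible_imp_stationary:
  assumes rev: "reversible_kernel \<pi> P"
  shows "stationary_distribution P \<pi>"
  unfolding stationary_distribution_def
proof (rule pmf_eqI)
  fix y
  have "ennreal (pmf (bind_pmf \<pi> P) y) = (\<integral>\<^sup>+x. ennreal (pmf \<pi> x * pmf (P x) y) \<partial>count_space UNIV)"
    by (simp add: ennreal_pmf_bind nn_integral_measure_pmf ennreal_mult)
  also have "\<dots> = (\<integral>\<^sup>+x. ennreal (pmf \<pi> y) * ennreal (pmf (P y) x) \<partial>count_space UNIV)"
  proof -
    have "ennreal (pmf \<pi> x * pmf (P x) y) = ennreal (pmf \<pi> y) * ennreal (pmf (P y) x)" for x
      using rev by (simp add: reversible_kernel_def flip: ennreal_mult)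
    then show ?thesis by (simp only:)
  qed
  also have "\<dots> = ennreal (pmf \<pi> y) * (\<integral>\<^sup>+x. ennreal (pmf (P y) x) \<partial>count_space UNIV)"
    by (rule nn_integral_cmult) simp
  also have "(\<integral>\<^sup>+x. ennreal (pmf (P y) x) \<partial>count_space UNIV) = 1"
    by (simp add: nn_integral_pmf)
  finally show "pmf (bind_pmf \<pi> P) y = pmf \<pi> y" by simp
qed

lemma stationary_kernel_comp:
  "stationary_distribution P \<pi> \<Longrightarrow> stationary_distribution Q \<pi> \<Longrightarrow> stationary_distribution (kernel_comp P Q) \<pi>"
  by (simp add: stationary_distribution_def kernel_comp_def flip: bind_assoc_pmf)

lemma kernel_pow_add:
  "kernel_pow P (m + n) x = bind_pmf (kernel_pow P m x) (kernel_pow P n)"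
  by (induction n) (simp_all add: bind_return_pmf' kernel_comp_def bind_assoc_pmf)

definition reaches :: "('s \<Rightarrow> 's pmf) \<Rightarrow> 's \<Rightarrow> 's \<Rightarrow> bool" where
  "reaches P x y \<longleftrightarrow> (\<exists>n. y \<in> set_pmf (kernel_pow P n x))"

lemma reaches_trans: "reaches P x y \<Longrightarrow> reaches P y z \<Longrightarrow> reaches P x z"
proof -
  assume "reaches P x y" "reaches P y z"
  then obtain m n where "y \<in> set_pmf (kernel_pow P m x)" "z \<in> set_pmf (kernel_pow P n y)"
    unfolding reaches_def by blast
  then have "z \<in> set_pmf (kernel_pow P (m + n) x)" by (auto simp: kernel_pow_add)
  then show ?thesis unfolding reaches_def by blast
qed

lemma reaches_step: "y \<in> set_pmf (P x) \<Longrightarrow> reaches P x y"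
  unfolding reaches_def by (rule exI[of _ 1]) (simp add: kernel_comp_def bind_return_pmf)

lemma irreducible_if_reaches: "(\<And>x y. reaches P x y) \<Longrightarrow> irreducible_kernel P"
  unfolding irreducible_kernel_def reaches_def by (simp add: pmf_positive_iff)

text \<open>Return paths that use the loop once or twice have consecutive lengths.\<close>
lemma aperiodic_if_self_loop:
  assumes irr: "irreducible_kernel P" and loop: "b \<in> set_pmf (P b)"
  shows "aperiodic_kernel P"
  unfolding aperiodic_kernel_def
proof
  fix x
  obtain m n where m: "b \<in> set_pmf (kernel_pow P m x)" and n: "x \<in> set_pmf (kernel_pow P n b)"
    using irr unfolding irreducible_kernel_def pmf_positive_iff by blast
  let ?S = "{n. 1 \<le> n \<and> pmf (kernel_pow P n x) x > 0}"
  have m1: "b \<in> set_pmf (kernel_pow P (Suc m) x)"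
    using m loop by (auto simp: kernel_comp_def)
  then have m2: "b \<in> set_pmf (kernel_pow P (Suc (Suc m)) x)"
    using loop by (auto simp: kernel_comp_def)
  have "x \<in> set_pmf (kernel_pow P (Suc m + n) x)" "x \<in> set_pmf (kernel_pow P (Suc (Suc m) + n) x)"
    unfolding kernel_pow_add[of P "Suc m" n] kernel_pow_add[of P "Suc (Suc m)" n] set_bind_pmf
    using m1 m2 n by blast+
  then have "Suc m + n \<in> ?S" "Suc (Suc m) + n \<in> ?S"
    by (auto simp only: pmf_positive_iff mem_Collect_eq)
  then have "Gcd ?S dvd Suc m + n" "Gcd ?S dvd Suc (Suc m) + n" by (auto intro: Gcd_dvd)
  then have "Gcd ?S dvd (Suc (Suc m) + n) - (Suc m + n)" by (intro dvd_diff_nat)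
  then show "Gcd ?S = 1" by simp
qed

text \<open>A criterion of Tonelli type for integrability with respect to a mixture.\<close>
lemma integral_bind_pmf_finite_bound:
  fixes F :: "'b \<Rightarrow> real"
  assumes "\<And>x. x \<in> set_pmf p \<Longrightarrow> integrable (measure_pmf (q x)) F"
    and "\<And>x. x \<in> set_pmf p \<Longrightarrow> (\<integral>y. \<bar>F y\<bar> \<partial>q x) \<le> C"
  shows "integrable (measure_pmf (bind_pmf p q)) F"
proof -
  have "(\<integral>\<^sup>+y. ennreal (norm (F y)) \<partial>bind_pmf p q) = (\<integral>\<^sup>+x. (\<integral>\<^sup>+y. ennreal (norm (F y)) \<partial>q x) \<partial>p)"
    by simp
  also have "\<dots> \<le> (\<integral>\<^sup>+x. ennreal C \<partial>p)"
  proof (intro nn_integral_mono_AE, simp only: AE_measure_pmf_iff, intro ballI)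
    fix x assume x: "x \<in> set_pmf p"
    have "(\<integral>\<^sup>+y. ennreal (norm (F y)) \<partial>q x) = ennreal (\<integral>y. norm (F y) \<partial>q x)"
      using assms(1)[OF x] by (intro nn_integral_eq_integral) auto
    then show "(\<integral>\<^sup>+y. ennreal (norm (F y)) \<partial>q x) \<le> ennreal C"
      using assms(2)[OF x] by (simp add: ennreal_leI)
  qed
  also have "\<dots> < \<infinity>" by (simp add: measure_pmf.emeasure_space_1)
  finally show ?thesis by (simp add: integrable_iff_bounded)
qed

section \<open>The flower chain\<close>

text \<open>A petal and a position in it, the sign of the current passage, and the noise.\<close>
type_synonym petal_state = "(nat \<times> nat) \<times> bool \<times> bool"

definition coin :: "bool pmf" where "coin = pmf_of_set UNIV"

definition sg :: "bool \<Rightarrow> real" where "sg b = (if b then 1 else - 1)"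

lemma pmf_coin [simp]: "pmf coin b = 1/2"
  by (simp add: coin_def UNIV_bool)

lemma set_coin [simp]: "set_pmf coin = UNIV"
  by (simp add: coin_def)

lemma integral_coin: "(\<integral>b. (F b :: real) \<partial>coin) = (F True + F False) / 2"
  unfolding coin_def by (subst integral_pmf_of_set) (auto simp: UNIV_bool)

lemma map_Not_coin: "map_pmf Not coin = coin"
  unfolding coin_def by (rule map_pmf_of_set_bij_betw) (auto simp: bij_betw_def inj_on_def UNIV_bool image_def)

text \<open>
  Petal 0 consists of the base point only; the pattern there is 0. A lower bound of 2 for the other lengths
  makes it possible to stay at the base point.
\<close>
locale flower =
  fixes L :: "nat \<Rightarrow> nat" and f :: "nat \<Rightarrow> nat \<Rightarrow> real" and C :: real
  assumes L_0: "L 0 = 1" and L_ge: "\<And>i. i > 0 \<Longrightarrow> L i \<ge> 2"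
    and f_0: "\<And>x. f 0 x = 0" and f_support: "\<And>i x. x \<ge> L i \<Longrightarrow> f i x = 0"
    and f_sum: "\<And>i. (\<Sum>x<L i. f i x) = 0"
    and f_energy: "\<And>i. autocorr (f i) (L i) 0 \<le> C"
begin

text \<open>Only pairs with \<open>j < L i\<close> are positions. The kernels below are meaningful on this set, which they preserve.\<close>
definition states :: "petal_state set" where "states = {((i, j), s, z). j < L i}"

definition \<theta> :: "nat pmf" where "\<theta> = geometric_pmf (1/2)"

lemma pmf_\<theta>: "pmf \<theta> i = (1/2) ^ Suc i"
  by (simp add: \<theta>_def)

lemma set_\<theta>: "set_pmf \<theta> = UNIV"
  by (simp add: \<theta>_def set_pmf_geometric)

lemma L_pos: "L i > 0"
  using L_0 L_ge[of i] by (cases "i = 0") auto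

text \<open>
  The petal entered from the base point. Petal \<open>i\<close> is proposed with weight \<open>2\<^bsup>-i\<^esup>\<close> and
  accepted with probability \<open>1 / L i\<close>, which balances the stationary weight \<open>\<theta>\<^sub>i / L\<^sub>i\<close>
  of each of its positions; after a rejection the chain stays at the base point.
\<close>
definition jump :: "nat pmf" where
  "jump = bind_pmf \<theta> (\<lambda>m. map_pmf (\<lambda>b. if b then Suc m else 0) (bernoulli_pmf (1 / real (L (Suc m)))))"

lemma pmf_jump:
  assumes "i > 0"
  shows "pmf jump i = 2 * pmf \<theta> i / real (L i)"
proof -
  obtain m where i: "i = Suc m" using assms by (cases i) auto
  let ?q = "\<lambda>m. map_pmf (\<lambda>b. if b then Suc m else 0) (bernoulli_pmf (1 / real (L (Suc m))))"
  have q: "pmf (?q n) (Suc m) = (if n = m then 1 / real (L i) else 0)" for n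
  proof -
    have "(\<lambda>b. if b then Suc n else 0) -` {Suc m} = (if n = m then {True} else {})"
      by (auto split: if_splits)
    then show ?thesis using L_ge[of i] i by (auto simp: pmf_map measure_pmf_single)
  qed
  have "pmf jump i = (\<integral>n. pmf (?q n) (Suc m) \<partial>\<theta>)"
    unfolding jump_def i by (rule pmf_bind)
  also have "\<dots> = pmf (?q m) (Suc m) * pmf \<theta> m"
    unfolding q by (subst integral_measure_pmf_real[where A = "{m}"]) (auto split: if_splits)
  also have "\<dots> = 2 * pmf \<theta> i / real (L i)" by (simp only: q pmf_\<theta>) (simp add: i)
  finally show ?thesis .
qed

lemma set_jump: "set_pmf jump = UNIV"
proof -
  have "i \<in> set_pmf jump" for i
  proof (cases "i = 0")
    case True
    have "1 / real (L 1) < 1" using L_ge[of 1] by simp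
    then have "False \<in> set_pmf (bernoulli_pmf (1 / real (L (Suc 0))))"
      using L_pos[of 1] by (subst set_pmf_bernoulli) auto
    then show ?thesis unfolding jump_def using True by (auto simp: set_\<theta> intro!: exI[of _ 0] image_eqI[of _ _ False])
  next
    case False
    then have "pmf jump i > 0" using pmf_jump[of i] L_pos[of i] by (simp add: pmf_\<theta>)
    then show ?thesis by (simp add: pmf_positive_iff)
  qed
  then show ?thesis by auto
qed

text \<open>All states of one petal; the stationary law is uniform on it, given the petal.\<close>
definition block :: "nat \<Rightarrow> petal_state set" where
  "block i = ({i} \<times> {..<L i}) \<times> UNIV"

lemma block: "finite (block i)" "block i \<noteq> {}" "card (block i) = 4 * L i"
  using L_pos[of i] by (auto simp: block_def card_cartesian_product UNIV_bool simp flip: UNIV_Times_UNIV)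

definition \<pi> :: "petal_state pmf" where
  "\<pi> = bind_pmf \<theta> (\<lambda>i. pmf_of_set (block i))"

lemma pmf_\<pi>: "pmf \<pi> ((i, j), s, z) = (if j < L i then pmf \<theta> i / (4 * real (L i)) else 0)"
proof -
  have "pmf \<pi> ((i, j), s, z) = (\<integral>n. pmf (pmf_of_set (block n)) ((i, j), s, z) \<partial>\<theta>)"
    unfolding \<pi>_def by (rule pmf_bind)
  also have "\<dots> = pmf (pmf_of_set (block i)) ((i, j), s, z) * pmf \<theta> i"
    using block by (subst integral_measure_pmf_real[where A = "{i}"]) (auto simp: block_def indicator_def)
  also have "pmf (pmf_of_set (block i)) ((i, j), s, z) = (if j < L i then 1 / (4 * real (L i)) else 0)"
    using block[of i] by (simp add: indicator_def) (simp add: block_def)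
  finally show ?thesis by simp
qed

lemma set_\<pi>: "set_pmf \<pi> = states"
  unfolding \<pi>_def using block by (auto simp: set_\<theta> states_def) (auto simp: block_def)

lemma integral_block:
  "(\<integral>x. F x \<partial>pmf_of_set (block i)) = (\<Sum>j<L i. \<Sum>s\<in>UNIV. \<Sum>z\<in>UNIV. (F ((i, j), s, z) :: real)) / (4 * real (L i))"
proof -
  have "sum F (block i) = (\<Sum>j<L i. \<Sum>s\<in>UNIV. \<Sum>z\<in>UNIV. F ((i, j), s, z))"
    unfolding block_def UNIV_Times_UNIV[symmetric] sum.cartesian_product' by simp
  then show ?thesis using block[of i] by (simp add: integral_pmf_of_set)
qed


definition reflect :: "petal_state \<Rightarrow> petal_state" where
  "reflect = (\<lambda>((i, j), w). ((i, L i - Suc j), w))"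

text \<open>
  The reversible kernel that randomizes. Inside a petal it is the reflection \<open>j \<mapsto> L i - j\<close> of the positions
  \<open>1..L i - 1\<close>; the position 0 is exchanged with the base point, and there a new sign
  is drawn. Composed with \<open>reflect\<close>, it advances the position by 1.
\<close>
definition turn :: "petal_state \<Rightarrow> petal_state pmf" where
  "turn = (\<lambda>((i, j), s, z).
     if i = 0 then pair_pmf (pair_pmf jump (return_pmf 0)) (pair_pmf coin coin)
     else if j = 0 then pair_pmf (return_pmf (0, 0)) (pair_pmf coin coin)
     else pair_pmf (return_pmf (i, L i - j)) (pair_pmf (return_pmf s) coin))"

definition walk :: "petal_state \<Rightarrow> petal_state pmf" where "walk x = turn (reflect x)"

lemma reflect_states: "x \<in> states \<Longrightarrow> reflect x \<in> states"
  using L_pos by (auto simp: states_def reflect_def)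

lemma reflect_reflect: "x \<in> states \<Longrightarrow> reflect (reflect x) = x"
  by (auto simp: states_def reflect_def)

lemma pmf_\<pi>_reflect: "x \<in> states \<Longrightarrow> pmf \<pi> (reflect x) = pmf \<pi> x"
  using L_pos by (auto simp: states_def reflect_def pmf_\<pi>)

lemma set_turn: "x \<in> states \<Longrightarrow> set_pmf (turn x) \<subseteq> states"
  using L_pos by (auto simp: states_def turn_def split: if_splits)

lemma set_walk: "x \<in> states \<Longrightarrow> set_pmf (walk x) \<subseteq> states"
  unfolding walk_def by (intro set_turn reflect_states)

lemma turn_reversible:
  assumes "x \<in> states" "y \<in> states"
  shows "pmf \<pi> x * pmf (turn x) y = pmf \<pi> y * pmf (turn y) x"
proof -
  obtain i j s z where x: "x = ((i, j), s, z)" by (metis prod.exhaust)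
  obtain i' j' s' z' where y: "y = ((i', j'), s', z')" by (metis prod.exhaust)
  have j: "j < L i" "j' < L i'" using assms x y by (auto simp: states_def)
  have base: "pmf \<pi> ((0, 0), c) * pmf (turn ((0, 0), c)) ((k, l), w) = pmf \<pi> ((k, l), w) * pmf (turn ((k, l), w)) ((0, 0), c)"
    if k: "k > 0" and l: "l < L k" for c k l w
  proof -
    obtain c1 c2 w1 w2 where cw: "c = (c1, c2)" "w = (w1, w2)" by (metis prod.exhaust)
    show ?thesis
      using k l L_pos[of k] unfolding cw
      by (simp add: turn_def pmf_pair pmf_\<pi> pmf_jump L_0 indicator_def) (simp add: pmf_\<theta>)
  qed
  consider "i = 0" "i' = 0" | "i = 0" "i' > 0" | "i > 0" "i' = 0" | "i > 0" "i' > 0" by blast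
  then show ?thesis
  proof cases
    case 1
    then show ?thesis using j by (simp add: x y turn_def pmf_pair pmf_\<pi> L_0)
  next
    case 2
    then show ?thesis using j base[of i' j' "(s, z)" "(s', z')"] by (simp add: x y L_0)
  next
    case 3
    then show ?thesis using j base[of i j "(s', z')" "(s, z)"] by (simp add: x y L_0)
  next
    case 4
    then show ?thesis using j by (auto simp: x y turn_def pmf_pair pmf_\<pi> indicator_def)
  qed
qed

lemma walk_base: "walk ((0, 0), s, z) = pair_pmf (pair_pmf jump (return_pmf 0)) (pair_pmf coin coin)"
  by (simp add: walk_def reflect_def turn_def)

lemma walk_last: "i > 0 \<Longrightarrow> Suc j = L i \<Longrightarrow> walk ((i, j), s, z) = pair_pmf (return_pmf (0, 0)) (pair_pmf coin coin)"
  by (simp add: walk_def reflect_def turn_def)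

lemma walk_mid: "i > 0 \<Longrightarrow> Suc j < L i \<Longrightarrow> walk ((i, j), s, z) = pair_pmf (return_pmf (i, Suc j)) (pair_pmf (return_pmf s) coin)"
  by (simp add: walk_def reflect_def turn_def)

text \<open>The three kinds of transition: at the base point, at the last position of a petal, and elsewhere in a petal.\<close>
lemma states_cases [consumes 1, case_names base last mid]:
  assumes "x \<in> states"
  obtains s z where "x = ((0, 0), s, z)"
  | i j s z where "x = ((i, j), s, z)" "i > 0" "Suc j = L i"
  | i j s z where "x = ((i, j), s, z)" "i > 0" "Suc j < L i"
proof -
  obtain i j s z where x: "x = ((i, j), s, z)" by (metis prod.exhaust)
  then have "j < L i" using assms by (auto simp: states_def)
  then show ?thesis using that x L_0 by (cases "i = 0"; cases "Suc j = L i") auto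
qed

lemma map_noise_walk: "x \<in> states \<Longrightarrow> map_pmf (\<lambda>y. snd (snd y)) (walk x) = coin"
proof -
  have snd2: "map_pmf (\<lambda>y. snd (snd y)) (pair_pmf A (pair_pmf B coin)) = coin" for A :: "(nat \<times> nat) pmf" and B :: "bool pmf"
    using map_pmf_comp[of snd snd "pair_pmf A (pair_pmf B coin)"] by (simp add: map_snd_pair_pmf)
  assume "x \<in> states"
  then show ?thesis
    by (cases rule: states_cases) (simp_all add: walk_base walk_last walk_mid snd2)
qed

text \<open>
  With this factor the contribution of petal \<open>i\<close> to the covariances is \<open>2 * \<theta>\<^sub>i\<close> times
  the autocorrelation of \<open>f i\<close>, independently of the length of the petal.
\<close>
definition amp :: "nat \<Rightarrow> nat \<Rightarrow> real" where "amp i j = sqrt (2 * real (L i)) * f i j"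

lemma amp_mult: "amp i j * amp i l = real (L i) * (2 * (f i j * f i l))"
proof -
  have "amp i j * amp i l = (sqrt (2 * real (L i)))\<^sup>2 * (f i j * f i l)"
    by (simp only: amp_def power2_eq_square mult_ac)
  then show ?thesis by simp
qed

text \<open>
  The conditional expectation of \<open>h(X\<^sub>l)\<close>; for \<open>l = 0\<close> it is \<open>h\<close> itself. The value in a petal is the
  pattern \<open>l\<close> positions ahead, and it is 0 if the petal ends before, since the next passage has
  a fresh sign. The pattern vanishes beyond its length, so no case distinction is needed.
\<close>
definition forecast :: "nat \<Rightarrow> petal_state \<Rightarrow> real" where
  "forecast l = (\<lambda>((i, j), s, z). of_bool (l = 0) * sg z + sg s * amp i (j + l))"

text \<open>
  The signed sum of the pattern over the part of the passage already made. As the whole pattern has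
  sum zero, it returns to 0 at the base point.
\<close>
definition G :: "petal_state \<Rightarrow> real" where
  "G = (\<lambda>((i, j), s, z). sg s * (\<Sum>k<j. amp i k))"

definition g :: "petal_state \<Rightarrow> real" where
  "g = (\<lambda>((i, j), s, z). sg s * amp i j)"

lemma forecast_0: "forecast 0 x = sg (snd (snd x)) + g x"
  by (simp add: forecast_def g_def case_prod_beta)

lemma amp_0: "amp 0 j = 0" by (simp add: amp_def f_0)

lemma amp_sum: "(\<Sum>k<L i. amp i k) = 0"
  using f_sum[of i] by (simp add: amp_def sum_distrib_left[symmetric])

lemma g_coboundary:
  assumes "x \<in> states" "y \<in> set_pmf (walk x)"
  shows "g x = G y - G x"
  using assms(1)
proof (cases rule: states_cases)
  case (base s z)
  then show ?thesis using assms(2) by (auto simp: walk_base g_def G_def amp_0)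
next
  case (last i j s z)
  then have "(\<Sum>k<j. amp i k) + amp i j = 0" using amp_sum[of i] by (simp flip: last(3))
  then have "sg s * ((\<Sum>k<j. amp i k) + amp i j) = 0" by simp
  then show ?thesis using assms(2) last by (auto simp: walk_last g_def G_def amp_0 distrib_left)
next
  case (mid i j s z)
  then show ?thesis using assms(2) by (auto simp: walk_mid g_def G_def distrib_left)
qed

text \<open>
  Flipping both coins preserves the law. The argument applies to every odd function, integrable or not,
  so the unbounded values at the entrances of the petals need no estimate.
\<close>
lemma integral_pair_coins_odd:
  fixes F :: "petal_state \<Rightarrow> real"
  assumes odd: "\<And>p s z. F (p, \<not> s, \<not> z) = - F (p, s, z)"
  shows "(\<integral>x. F x \<partial>pair_pmf A (pair_pmf coin coin)) = 0"
proof -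
  let ?M = "pair_pmf A (pair_pmf coin coin)"
  have "?M = pair_pmf A (pair_pmf (map_pmf Not coin) (map_pmf Not coin))"
    by (simp only: map_Not_coin)
  also have "\<dots> = map_pmf (apsnd (apsnd Not)) (map_pmf (apsnd (apfst Not)) ?M)"
    by (simp only: pair_map_pmf1 pair_map_pmf2)
  finally have "(\<integral>x. F x \<partial>?M) = (\<integral>x. F x \<partial>map_pmf (apsnd (apsnd Not)) (map_pmf (apsnd (apfst Not)) ?M))"
    by (rule arg_cong)
  also have "\<dots> = (\<integral>x. - F x \<partial>?M)"
    by (simp only: integral_map_pmf) (intro Bochner_Integration.integral_cong refl, auto simp: odd)
  finally show ?thesis by simp
qed

lemma sg_Not: "sg (\<not> b) = - sg b" by (simp add: sg_def)

lemma integral_walk_forecast: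
  assumes "x \<in> states"
  shows "(\<integral>y. forecast l y \<partial>walk x) = forecast (Suc l) x"
  using assms
proof (cases rule: states_cases)
  case (base s z)
  have "(\<integral>y. forecast l y \<partial>walk x) = 0"
    unfolding base walk_base by (rule integral_pair_coins_odd) (auto simp: forecast_def sg_Not)
  then show ?thesis by (simp add: base forecast_def amp_0)
next
  case (last i j s z)
  have "(\<integral>y. forecast l y \<partial>walk x) = 0"
    unfolding last(1) walk_last[OF last(2,3)] by (rule integral_pair_coins_odd) (auto simp: forecast_def sg_Not)
  then show ?thesis using last by (simp add: forecast_def amp_def f_support)
next
  case (mid i j s z)
  then show ?thesis
    by (simp add: walk_mid pair_return_pmf1 integral_coin forecast_def) (simp add: sg_def)
qed

text \<open>Averaging over the two signs removes the mixed terms of noise and pattern.\<close>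
lemma integral_block_product:
  "(\<integral>x. forecast 0 x * forecast k x \<partial>pmf_of_set (block i)) = of_bool (k = 0) + 2 * autocorr (f i) (L i) k"
proof -
  have "(\<Sum>s\<in>UNIV. \<Sum>z\<in>UNIV. forecast 0 ((i, j), s, z) * forecast k ((i, j), s, z)) = 4 * (of_bool (k = 0) + amp i j * amp i (j + k))" for j
    by (simp add: UNIV_bool forecast_def sg_def algebra_simps)
  then have "(\<integral>x. forecast 0 x * forecast k x \<partial>pmf_of_set (block i)) = (\<Sum>j<L i. 4 * (of_bool (k = 0) + amp i j * amp i (j + k))) / (4 * real (L i))"
    by (simp only: integral_block)
  also have "\<dots> = (\<Sum>j<L i. of_bool (k = 0) + amp i j * amp i (j + k)) / real (L i)"
    unfolding sum_distrib_left[symmetric] by simp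
  also have "(\<Sum>j<L i. of_bool (k = 0) + amp i j * amp i (j + k)) = real (L i) * (of_bool (k = 0) + 2 * autocorr (f i) (L i) k)"
    unfolding sum.distrib amp_mult autocorr_def sum_distrib_left[symmetric] by (simp add: algebra_simps)
  finally show ?thesis using L_pos[of i] by simp
qed

lemma integral_block_forecast: "(\<integral>x. forecast 0 x \<partial>pmf_of_set (block i)) = 0"
  by (simp add: integral_block UNIV_bool forecast_def sg_def)

lemma integrable_block: "integrable (measure_pmf (pmf_of_set (block i))) (F :: _ \<Rightarrow> real)"
  using block[of i] by (intro integrable_measure_pmf_finite) simp

lemma integrable_square_forecast: "integrable (measure_pmf \<pi>) (\<lambda>x. (forecast 0 x)\<^sup>2)"
  unfolding \<pi>_def
proof (rule integral_bind_pmf_finite_bound)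
  fix i
  show "(\<integral>y. \<bar>(forecast 0 y)\<^sup>2\<bar> \<partial>pmf_of_set (block i)) \<le> 1 + 2 * C"
    using integral_block_product[where k = 0 and i = i] f_energy[of i] by (simp flip: power2_eq_square)
qed (rule integrable_block)

lemma expectation_forecast: "(\<integral>x. forecast 0 x \<partial>\<pi>) = 0"
proof -
  have "integrable (measure_pmf \<pi>) (forecast 0)"
    using integrable_square_forecast by (rule measure_pmf.square_integrable_imp_integrable[rotated]) simp
  then show ?thesis
    unfolding \<pi>_def by (subst integral_bind_pmf_iterated) (simp_all add: integral_block_forecast)
qed

lemma expectation_forecast_product:
  assumes "integrable (measure_pmf \<pi>) (\<lambda>x. forecast 0 x * forecast k x)"
  shows "(\<integral>x. forecast 0 x * forecast k x \<partial>\<pi>) = of_bool (k = 0) + 2 * (\<integral>i. autocorr (f i) (L i) k \<partial>\<theta>)"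
    and "integrable (measure_pmf \<theta>) (\<lambda>i. autocorr (f i) (L i) k)"
proof -
  have "integrable (measure_pmf \<theta>) (\<lambda>i. of_bool (k = 0) + 2 * autocorr (f i) (L i) k)"
    using integrable_bind_pmf_inner[OF assms[unfolded \<pi>_def]] by (simp add: integral_block_product)
  from Bochner_Integration.integrable_diff[OF this, of "\<lambda>_. of_bool (k = 0)"]
  show int: "integrable (measure_pmf \<theta>) (\<lambda>i. autocorr (f i) (L i) k)" by simp
  show "(\<integral>x. forecast 0 x * forecast k x \<partial>\<pi>) = of_bool (k = 0) + 2 * (\<integral>i. autocorr (f i) (L i) k \<partial>\<theta>)"
    using integral_bind_pmf_iterated[OF assms[unfolded \<pi>_def]] int
    by (simp add: integral_block_product \<pi>_def)
qed

end

section \<open>The flower chain on the natural numbers\<close>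

lemma map_sg_coin: "map_pmf sg coin = fair_sign"
proof -
  have "map_pmf sg (pmf_of_set UNIV) = pmf_of_set (sg ` UNIV)"
    by (intro map_pmf_of_set_inj) (auto simp: inj_on_def sg_def)
  also have "sg ` UNIV = {- 1, 1}" by (auto simp: sg_def image_def)
  finally show ?thesis by (simp add: coin_def fair_sign_def)
qed

context flower
begin

text \<open>The valid states are countably many, infinitely many, and hence in bijection with the natural numbers.\<close>
definition enc :: "petal_state \<Rightarrow> nat" where "enc = to_nat_on states"
definition dec :: "nat \<Rightarrow> petal_state" where "dec = from_nat_into states"

lemma infinite_states: "infinite states"
proof
  assume "finite states"
  moreover have "range (\<lambda>i. ((i, 0), True, True)) \<subseteq> states" using L_pos by (auto simp: states_def)
  ultimately have "finite (range (\<lambda>i::nat. ((i, 0::nat), True, True)))" by (rule finite_subset[rotated])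
  moreover have "inj (\<lambda>i::nat. ((i, 0::nat), True, True))" by (simp add: inj_def)
  ultimately show False using finite_imageD infinite_UNIV_nat by blast
qed

lemma countable_states: "countable states" by simp

lemma dec_states: "dec n \<in> states"
  unfolding dec_def using infinite_states by (intro from_nat_into) auto

lemma dec_enc: "x \<in> states \<Longrightarrow> dec (enc x) = x"
  unfolding dec_def enc_def using countable_states by (rule from_nat_into_to_nat_on)

lemma enc_dec: "enc (dec n) = n"
  unfolding dec_def enc_def using countable_states infinite_states by (rule to_nat_on_from_nat_into_infinite)

lemma pmf_enc:
  assumes "set_pmf p \<subseteq> states"
  shows "pmf (map_pmf enc p) n = pmf p (dec n)"
proof -
  have "pmf (map_pmf enc p) n = measure p (enc -` {n})" by (simp add: pmf_map)
  also have "\<dots> = measure p (enc -` {n} \<inter> set_pmf p)" by (simp add: measure_Int_set_pmf)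
  also have "enc -` {n} \<inter> set_pmf p = {dec n} \<inter> set_pmf p"
    using assms dec_enc enc_dec by (auto simp: subset_iff)
  also have "measure p \<dots> = pmf p (dec n)" by (simp only: measure_Int_set_pmf measure_pmf_single)
  finally show ?thesis .
qed

lemma integral_enc:
  assumes "set_pmf p \<subseteq> states"
  shows "(\<integral>n. F (dec n) \<partial>map_pmf enc p) = (\<integral>x. (F x :: real) \<partial>p)"
    and "integrable (map_pmf enc p) (\<lambda>n. F (dec n)) \<longleftrightarrow> integrable p F"
proof -
  have ae: "AE x in p. F (dec (enc x)) = F x"
    using assms dec_enc by (auto simp: AE_measure_pmf_iff subset_iff)
  show "(\<integral>n. F (dec n) \<partial>map_pmf enc p) = (\<integral>x. F x \<partial>p)"
    using ae by (simp, intro integral_cong_AE) auto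
  show "integrable (map_pmf enc p) (\<lambda>n. F (dec n)) \<longleftrightarrow> integrable p F"
    using ae by (simp, intro integrable_cong_AE) auto
qed

definition P1 :: "nat \<Rightarrow> nat pmf" where "P1 n = return_pmf (enc (reflect (dec n)))"
definition P2 :: "nat \<Rightarrow> nat pmf" where "P2 n = map_pmf enc (turn (dec n))"
definition P :: "nat \<Rightarrow> nat pmf" where "P = kernel_comp P1 P2"
definition \<pi>' :: "nat pmf" where "\<pi>' = map_pmf enc \<pi>"
definition h :: "nat \<Rightarrow> real" where "h n = forecast 0 (dec n)"

lemma P_eq: "P n = map_pmf enc (walk (dec n))"
  by (simp add: P_def kernel_comp_def P1_def P2_def bind_return_pmf dec_enc reflect_states dec_states walk_def)

lemma pmf_\<pi>': "pmf \<pi>' n = pmf \<pi> (dec n)"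
  unfolding \<pi>'_def by (rule pmf_enc) (simp add: set_\<pi>)

lemma pmf_\<pi>'_pos: "pmf \<pi>' n > 0"
  using dec_states[of n] unfolding pmf_\<pi>' pmf_positive_iff set_\<pi> .

lemma P1_reversible: "reversible_kernel \<pi>' P1"
  unfolding reversible_kernel_def
proof (intro allI)
  fix n m
  have swap: "enc (reflect (dec n)) = m \<longleftrightarrow> enc (reflect (dec m)) = n"
    by (metis dec_states dec_enc enc_dec reflect_states reflect_reflect)
  show "pmf \<pi>' n * pmf (P1 n) m = pmf \<pi>' m * pmf (P1 m) n"
  proof (cases "enc (reflect (dec n)) = m")
    case True
    then have "dec m = reflect (dec n)" using dec_enc dec_states reflect_states by blast
    then have "pmf \<pi>' m = pmf \<pi>' n" by (simp add: pmf_\<pi>' pmf_\<pi>_reflect dec_states)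
    then show ?thesis using True swap by (simp add: P1_def)
  next
    case False
    then show ?thesis using swap by (simp add: P1_def indicator_def)
  qed
qed

lemma P2_reversible: "reversible_kernel \<pi>' P2"
  unfolding reversible_kernel_def P2_def pmf_\<pi>'
  by (simp add: pmf_enc set_turn dec_states turn_reversible)

lemma P_stationary: "stationary_distribution P \<pi>'"
  unfolding P_def
  by (intro stationary_kernel_comp reversible_imp_stationary P1_reversible P2_reversible)

lemma reaches_enc_step: "x \<in> states \<Longrightarrow> y \<in> set_pmf (walk x) \<Longrightarrow> reaches P (enc x) (enc y)"
  by (rule reaches_step) (auto simp: P_eq dec_enc)

lemma reaches_along_petal:
  assumes "i > 0" "j < L i"
  shows "reaches P (enc ((i, 0), s, z)) (enc ((i, j), s, z))"
  using assms(2)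
proof (induction j)
  case 0
  show ?case unfolding reaches_def by (rule exI[of _ 0]) simp
next
  case (Suc j)
  have "reaches P (enc ((i, j), s, z)) (enc ((i, Suc j), s, z))"
    using Suc.prems assms(1) by (intro reaches_enc_step) (auto simp: states_def walk_mid)
  then show ?case using Suc by (auto intro: reaches_trans)
qed

lemma reaches_petal_end:
  assumes "i > 0" "j < L i"
  shows "reaches P (enc ((i, j), s, z)) (enc ((0, 0), t, w))"
  using assms(2)
proof (induction "L i - j" arbitrary: j z rule: less_induct)
  case less
  show ?case
  proof (cases "Suc j = L i")
    case True
    then show ?thesis using less assms(1) by (intro reaches_enc_step) (auto simp: states_def walk_last)
  next
    case False
    then have "reaches P (enc ((i, j), s, z)) (enc ((i, Suc j), s, z))"
      using less.prems assms(1) by (intro reaches_enc_step) (auto simp: states_def walk_mid)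
    moreover have "reaches P (enc ((i, Suc j), s, z)) (enc ((0, 0), t, w))"
      using False less.prems by (intro less.hyps) auto
    ultimately show ?thesis by (rule reaches_trans)
  qed
qed

lemma P_irreducible: "irreducible_kernel P"
proof (rule irreducible_if_reaches)
  fix n m
  let ?b = "enc ((0, 0), True, True)"
  have from_base: "reaches P (enc ((0, 0), s, z)) (enc ((i, 0), s', z'))" for s z i s' z'
    using L_pos by (intro reaches_enc_step) (auto simp: states_def walk_base set_jump L_0)
  have "reaches P (enc x) ?b" if "x \<in> states" for x
    using that
  proof (cases rule: states_cases)
    case (base s z)
    then show ?thesis using from_base by simp
  qed (auto intro!: reaches_petal_end)
  then have 1: "reaches P n ?b" using dec_states enc_dec by metis
  have "reaches P ?b (enc x)" if x: "x \<in> states" for x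
  proof -
    obtain i j s z where x_eq: "x = ((i, j), s, z)" by (metis prod.exhaust)
    show ?thesis
    proof (cases "i = 0")
      case True
      then show ?thesis using from_base x x_eq L_0 by (simp add: states_def)
    next
      case False
      then show ?thesis
        using reaches_trans[OF from_base reaches_along_petal] x x_eq by (auto simp: states_def)
    qed
  qed
  then have 2: "reaches P ?b m" using dec_states enc_dec by metis
  show "reaches P n m" using 1 2 by (rule reaches_trans)
qed

lemma P_aperiodic: "aperiodic_kernel P"
proof (rule aperiodic_if_self_loop[OF P_irreducible])
  \<comment> \<open>A rejected proposal leaves the chain at the base point.\<close>
  let ?x = "((0, 0), True, True) :: petal_state"
  have "?x \<in> states" by (simp add: states_def L_0)
  moreover have "?x \<in> set_pmf (walk ?x)" by (simp add: walk_base set_jump)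
  ultimately show "enc ?x \<in> set_pmf (P (enc ?x))" by (simp add: P_eq dec_enc)
qed

lemma P_positive_recurrent: "positive_recurrent_kernel P"
  using P_stationary pmf_\<pi>'_pos by (rule positive_recurrent_if_stationary)

lemma h_square_integrable: "integrable (measure_pmf \<pi>') (\<lambda>n. (h n)\<^sup>2)"
  unfolding h_def \<pi>'_def
  using integral_enc(2)[of \<pi> "\<lambda>x. (forecast 0 x)\<^sup>2"] integrable_square_forecast by (simp add: set_\<pi>)

lemma h_mean: "measure_pmf.expectation \<pi>' h = 0"
  using integral_enc(1)[of \<pi> "forecast 0"] expectation_forecast by (simp add: h_def[abs_def] \<pi>'_def set_\<pi>)

lemma P_autocov:
  "autocov \<pi>' P h k = of_bool (k = 0) + 2 * (\<integral>i. autocorr (f i) (L i) k \<partial>\<theta>)"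
  and integrable_autocorr: "integrable (measure_pmf \<theta>) (\<lambda>i. autocorr (f i) (L i) k)"
proof -
  have h_eq: "h = (\<lambda>n. forecast 0 (dec n))" by (simp add: h_def[abs_def])
  have step: "(\<integral>m. forecast l (dec m) \<partial>P n) = forecast (Suc l) (dec n)" for l n
    unfolding P_eq using integral_enc(1)[OF set_walk[OF dec_states], where F = "forecast l"] integral_walk_forecast[OF dec_states] by simp
  note ac = autocov_eq_conditional_expectation[OF P_stationary h_square_integrable,
      of "\<lambda>l n. forecast l (dec n)", OF h_eq[symmetric] step]
  have "integrable (map_pmf enc \<pi>) (\<lambda>n. forecast 0 (dec n) * forecast k (dec n))"
    using ac(2)[of k] unfolding \<pi>'_def h_def .
  then have int: "integrable (measure_pmf \<pi>) (\<lambda>x. forecast 0 x * forecast k x)"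
    using integral_enc(2)[of \<pi> "\<lambda>x. forecast 0 x * forecast k x"] by (simp only: set_\<pi> subset_refl)
  have "autocov \<pi>' P h k = (\<integral>n. forecast 0 (dec n) * forecast k (dec n) \<partial>map_pmf enc \<pi>)"
    using ac(1)[of k] unfolding \<pi>'_def h_def .
  also have "\<dots> = (\<integral>x. forecast 0 x * forecast k x \<partial>\<pi>)"
    by (rule integral_enc(1)) (simp add: set_\<pi>)
  finally show "autocov \<pi>' P h k = of_bool (k = 0) + 2 * (\<integral>i. autocorr (f i) (L i) k \<partial>\<theta>)"
    using expectation_forecast_product(1)[OF int] by simp
  show "integrable (measure_pmf \<theta>) (\<lambda>i. autocorr (f i) (L i) k)"
    using expectation_forecast_product(2)[OF int] .
qed

lemma P_B_seq: "B_seq \<pi>' P h m = 1 + 2 * (\<integral>i. corr_sum (f i) (L i) m \<partial>\<theta>)"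
  and integrable_corr_sum: "integrable (measure_pmf \<theta>) (\<lambda>i. corr_sum (f i) (L i) m)"
proof -
  have "(\<Sum>k=1..m. autocov \<pi>' P h k) = (\<Sum>k=1..m. 2 * (\<integral>i. autocorr (f i) (L i) k \<partial>\<theta>))"
    by (intro sum.cong refl) (auto simp: P_autocov)
  then show "B_seq \<pi>' P h m = 1 + 2 * (\<integral>i. corr_sum (f i) (L i) m \<partial>\<theta>)"
    using integrable_autocorr
    by (simp add: B_seq_def P_autocov corr_sum_def sum_distrib_left[symmetric])
  show "integrable (measure_pmf \<theta>) (\<lambda>i. corr_sum (f i) (L i) m)"
    unfolding corr_sum_def
    by (intro Bochner_Integration.integrable_add integrable_mult_right Bochner_Integration.integrable_sum integrable_autocorr)
qed

lemma P_CLT: "sqrt_n_CLT \<pi>' P h"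
proof (rule sqrt_n_CLT_sign_plus_coboundary[OF P_stationary,
      where e = "\<lambda>n. sg (snd (snd (dec n)))" and g = "\<lambda>n. g (dec n)" and G = "\<lambda>n. G (dec n)"])
  fix n
  have "map_pmf (\<lambda>m. sg (snd (snd (dec m)))) (P n) = map_pmf (\<lambda>y. sg (snd (snd (dec (enc y))))) (walk (dec n))"
    by (simp add: P_eq map_pmf_comp)
  also have "\<dots> = map_pmf (\<lambda>y. sg (snd (snd y))) (walk (dec n))"
    using set_walk[OF dec_states, of n] by (intro map_pmf_cong refl) (auto simp: dec_enc)
  also have "\<dots> = map_pmf sg (map_pmf (\<lambda>y. snd (snd y)) (walk (dec n)))"
    by (simp add: map_pmf_comp)
  also have "\<dots> = fair_sign" by (simp only: map_noise_walk[OF dec_states] map_sg_coin)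
  finally show "map_pmf (\<lambda>m. sg (snd (snd (dec m)))) (P n) = fair_sign" .
next
  fix n m assume "m \<in> set_pmf (P n)"
  then obtain y where y: "y \<in> set_pmf (walk (dec n))" "m = enc y" by (auto simp: P_eq)
  then have "dec m = y" using set_walk[OF dec_states, of n] by (auto simp: dec_enc)
  then show "g (dec n) = G (dec m) - G (dec n)" using g_coboundary[OF dec_states] y by simp
qed (simp add: h_def forecast_0)

end

section \<open>The example\<close>

text \<open>
  Petal \<open>i\<close> has stationary weight \<open>2\<^bsup>-i-1\<^esup>\<close>, so a peak of height \<open>i * 2\<^bsup>i+1\<^esup>\<close> in its pattern
  contributes \<open>i\<close> to the average.
\<close>
lemma example_exists:
  "\<exists>(P :: nat \<Rightarrow> nat pmf) (\<pi> :: nat pmf) (h :: nat \<Rightarrow> real) P1 P2.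
            P = kernel_comp P1 P2 \<and> reversible_kernel \<pi> P1 \<and> reversible_kernel \<pi> P2 \<and>
            irreducible_kernel P \<and> aperiodic_kernel P \<and> positive_recurrent_kernel P \<and>
            stationary_distribution P \<pi> \<and>
            integrable (measure_pmf \<pi>) (\<lambda>x. (h x)\<^sup>2) \<and> measure_pmf.expectation \<pi> h = 0 \<and>
            A_seq \<pi> P h \<longlonglongrightarrow> 1 \<and>
            liminf (\<lambda>n. ereal (B_seq \<pi> P h n)) = 1 \<and>
            limsup (\<lambda>n. ereal (B_seq \<pi> P h n)) = \<infinity> \<and>
            sqrt_n_CLT \<pi> P h"
proof -
  define good where "good i = (\<lambda>(f, L). L \<ge> 2 \<and> (\<forall>x\<ge>L. f x = 0) \<and> (\<Sum>x<L. f x) = 0 \<and>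
     (\<forall>m. corr_sum f L m \<ge> - 18) \<and> (\<forall>T. (\<Sum>m<T. corr_sum f L m) \<le> 18 * real T) \<and>
     (\<exists>m. corr_sum f L m \<ge> real i * 2 ^ Suc i))" for i :: nat
  have "\<exists>fL. good i fL" for i
    using spiky_pattern_exists[of "real i * 2 ^ Suc i"] unfolding good_def by simp
  then obtain fL where fL: "\<And>i. good i (fL i)" by metis
  define f where "f i = (if i = 0 then (\<lambda>_. 0) else fst (fL i))" for i
  define L where "L i = (if i = 0 then 1 else snd (fL i))" for i
  have f: "L i \<ge> 2 \<and> (\<forall>x\<ge>L i. f i x = 0) \<and> (\<Sum>x<L i. f i x) = 0 \<and>
     (\<forall>m. corr_sum (f i) (L i) m \<ge> - 18) \<and> (\<forall>T. (\<Sum>m<T. corr_sum (f i) (L i) m) \<le> 18 * real T) \<and>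
     (\<exists>m. corr_sum (f i) (L i) m \<ge> real i * 2 ^ Suc i)" if "i > 0" for i
    using fL[of i] that unfolding good_def f_def L_def by (simp add: case_prod_beta)
  have zero: "corr_sum (f 0) (L 0) m = 0" for m
    by (simp add: f_def corr_sum_def autocorr_def)
  have cases0: "i = 0 \<or> i > 0" for i :: nat by auto
  have vanish: "\<And>i x. x \<ge> L i \<Longrightarrow> f i x = 0" and sum0: "\<And>i. (\<Sum>x<L i. f i x) = 0"
    and lower: "\<And>i m. corr_sum (f i) (L i) m \<ge> - 18"
    and Cesaro: "\<And>i T. (\<Sum>m<T. corr_sum (f i) (L i) m) \<le> 18 * real T"
    subgoal for i x using f[of i] by (cases "i = 0") (auto simp: f_def)
    subgoal for i using f[of i] by (cases "i = 0") (auto simp: f_def)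
    subgoal for i m using f[of i] zero by (cases "i = 0") auto
    subgoal for i T using f[of i] zero by (cases "i = 0") auto
    done
  interpret flower L f 18
  proof
    show "L 0 = 1" "\<And>x. f 0 x = 0" by (simp_all add: L_def f_def)
    show "autocorr (f i) (L i) 0 \<le> 18" for i
      using Cesaro[where i = i and T = 1] by (simp add: corr_sum_def)
  qed (use f vanish sum0 in auto)
  interpret sparse_peaks \<theta> "\<lambda>i m. corr_sum (f i) (L i) m" L 18
  proof
    show "corr_sum (f i) (L i) m = 0" if "m \<ge> L i" for i m
      using corr_sum_eventually_square[OF vanish that] sum0 by simp
    fix i :: nat assume "i > 0"
    then obtain m where m: "corr_sum (f i) (L i) m \<ge> real i * 2 ^ Suc i" using f by blast
    have "real i = (1 / 2) ^ Suc i * (real i * 2 ^ Suc i)"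
      by (simp add: power_divide)
    also have "\<dots> \<le> (1 / 2) ^ Suc i * corr_sum (f i) (L i) m"
      using m by (intro mult_left_mono) auto
    finally show "\<exists>m. pmf \<theta> i * corr_sum (f i) (L i) m \<ge> real i"
      unfolding pmf_\<theta> by blast
  qed (use lower Cesaro integrable_corr_sum in auto)
  have B_eq: "B_seq \<pi>' P h = B" by (simp add: fun_eq_iff P_B_seq B_def)
  have A_eq: "A_seq \<pi>' P h = (\<lambda>n. (\<Sum>m<n. B m) / real n)"
    using A_seq_eq_Cesaro_B_seq[OF P_stationary h_square_integrable h_mean] by (simp add: fun_eq_iff B_eq)
  have "P = kernel_comp P1 P2 \<and> reversible_kernel \<pi>' P1 \<and> reversible_kernel \<pi>' P2 \<and>
      irreducible_kernel P \<and> aperiodic_kernel P \<and> positive_recurrent_kernel P \<and>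
      stationary_distribution P \<pi>' \<and>
      integrable (measure_pmf \<pi>') (\<lambda>x. (h x)\<^sup>2) \<and> measure_pmf.expectation \<pi>' h = 0 \<and>
      A_seq \<pi>' P h \<longlonglongrightarrow> 1 \<and>
      liminf (\<lambda>n. ereal (B_seq \<pi>' P h n)) = 1 \<and>
      limsup (\<lambda>n. ereal (B_seq \<pi>' P h n)) = \<infinity> \<and>
      sqrt_n_CLT \<pi>' P h"
    unfolding A_eq B_eq
    by (intro conjI P_def P1_reversible P2_reversible P_irreducible P_aperiodic P_positive_recurrent
        P_stationary h_square_integrable h_mean Cesaro_B liminf_B limsup_B P_CLT)
  then show ?thesis by (intro exI)
qed

theorem theorem5p4:
  shows "(\<exists>(P :: nat \<Rightarrow> nat pmf) (\<pi> :: nat pmf) (h :: nat \<Rightarrow> real).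
            irreducible_kernel P \<and> aperiodic_kernel P \<and> positive_recurrent_kernel P \<and>
            stationary_distribution P \<pi> \<and>
            integrable (measure_pmf \<pi>) (\<lambda>x. (h x)\<^sup>2) \<and> measure_pmf.expectation \<pi> h = 0 \<and>
            A_seq \<pi> P h \<longlonglongrightarrow> 1 \<and>
            liminf (\<lambda>n. ereal (B_seq \<pi> P h n)) = 1 \<and>
            limsup (\<lambda>n. ereal (B_seq \<pi> P h n)) = \<infinity> \<and>
            sqrt_n_CLT \<pi> P h) \<and>
         (\<exists>(P :: nat \<Rightarrow> nat pmf) (\<pi> :: nat pmf) (h :: nat \<Rightarrow> real) P1 P2.
            P = kernel_comp P1 P2 \<and> reversible_kernel \<pi> P1 \<and> reversible_kernel \<pi> P2 \<and>
            irreducible_kernel P \<and> aperiodic_kernel P \<and> positive_recurrent_kernel P \<and>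
            stationary_distribution P \<pi> \<and>
            integrable (measure_pmf \<pi>) (\<lambda>x. (h x)\<^sup>2) \<and> measure_pmf.expectation \<pi> h = 0 \<and>
            A_seq \<pi> P h \<longlonglongrightarrow> 1 \<and>
            liminf (\<lambda>n. ereal (B_seq \<pi> P h n)) = 1 \<and>
            limsup (\<lambda>n. ereal (B_seq \<pi> P h n)) = \<infinity> \<and>
            sqrt_n_CLT \<pi> P h)"
proof -
  obtain P :: "nat \<Rightarrow> nat pmf" and \<pi> :: "nat pmf" and h :: "nat \<Rightarrow> real" and P1 P2 where ex:
    "P = kernel_comp P1 P2 \<and> reversible_kernel \<pi> P1 \<and> reversible_kernel \<pi> P2 \<and>
     irreducible_kernel P \<and> aperiodic_kernel P \<and> positive_recurrent_kernel P \<and>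
     stationary_distribution P \<pi> \<and>
     integrable (measure_pmf \<pi>) (\<lambda>x. (h x)\<^sup>2) \<and> measure_pmf.expectation \<pi> h = 0 \<and>
     A_seq \<pi> P h \<longlonglongrightarrow> 1 \<and>
     liminf (\<lambda>n. ereal (B_seq \<pi> P h n)) = 1 \<and>
     limsup (\<lambda>n. ereal (B_seq \<pi> P h n)) = \<infinity> \<and>
     sqrt_n_CLT \<pi> P h"
    using example_exists by blast
  show ?thesis
  proof (rule conjI)
    show "\<exists>(P :: nat \<Rightarrow> nat pmf) (\<pi> :: nat pmf) (h :: nat \<Rightarrow> real).
            irreducible_kernel P \<and> aperiodic_kernel P \<and> positive_recurrent_kernel P \<and>
            stationary_distribution P \<pi> \<and>
            integrable (measure_pmf \<pi>) (\<lambda>x. (h x)\<^sup>2) \<and> measure_pmf.expectation \<pi> h = 0 \<and>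
            A_seq \<pi> P h \<longlonglongrightarrow> 1 \<and>
            liminf (\<lambda>n. ereal (B_seq \<pi> P h n)) = 1 \<and>
            limsup (\<lambda>n. ereal (B_seq \<pi> P h n)) = \<infinity> \<and>
            sqrt_n_CLT \<pi> P h"
      by (rule exI[of _ P], rule exI[of _ \<pi>], rule exI[of _ h]) (use ex in blast)
  qed (rule example_exists)
qed

end
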